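(* Let $p>3$ be a prime, $x\in\mathbb Z_p$ and $x'=(x-\langle x\rangle_p)/p$. Then $$\sum_{n=0}^{p-1}(2n+1)(-1)^nV_n(x)\equiv(-1)^{\langle x\rangle_p}p+p^3\big(x'(x'+1)+1\big)E_{p-3}(-x)\pmod{p^4}.$$ Consequently $$\sum_{n=0}^{p-1}(2n+1)\frac{V_n^{(3)}}{(-27)^n}\equiv(-1)^{[p/3]}p+7p^3U_{p-3}\pmod{p^4},\quad\sum_{n=0}^{p-1}(2n+1)\frac{V_n^{(4)}}{(-64)^n}\equiv(-1)^{[p/4]}p+13p^3s_{p-3}\pmod{p^4},$$ $$\sum_{n=0}^{p-1}(2n+1)\frac{V_n^{(6)}}{(-432)^n}\equiv(-1)^{\frac{p-1}2}p+\tfrac{155}9p^3E_{p-3}\pmod{p^4}.$$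
   Context: For real $x$ and integer $k\ge0$, $\binom xk=x(x-1)\cdots(x-k+1)/k!$. $V_n(x)=\sum_{k=0}^n\binom nk\binom{n+k}k(-1)^k\binom xk\binom{-1-x}k$. $\mathbb Z_p$: rationals with denominator prime to $p$; congruences modulo powers of $p$ are in $\mathbb Z_p$; for $x\in\mathbb Z_p$, $\langle x\rangle_p\in\{0,\ldots,p-1\}$ with $x\equiv\langle x\rangle_p\pmod p$. $[y]$ is the floor. Euler numbers: $E_{2n-1}=0$, $E_0=1$, $E_{2n}=-\sum_{k=1}^n\binom{2n}{2k}E_{2n-2k}$; Euler polynomials $E_n(x)=2^{-n}\sum_{k=0}^n\binom nk(2x-1)^{n-k}E_k$. $U_{2n-1}=0$, $U_0=1$, $U_{2n}=-2\sum_{k=1}^n\binom{2n}{2k}U_{2n-2k}$. $s_0=1$, $s_n=1-\sum_{k=0}^{n-1}\binom nk2^{2n-1-2k}s_k$ ($n\ge1$). $V_n^{(3)}=27^nV_n(-\tfrac13)$, $V_n^{(4)}=64^nV_n(-\tfrac14)$, $V_n^{(6)}=432^nV_n(-\tfrac16)$. *)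

theory Defs
  imports Complex_Main "HOL-Computational_Algebra.Primes"
begin

definition p_integers :: "nat \<Rightarrow> rat set" where
  "p_integers p = {x. coprime (snd (quotient_of x)) (int p)}"

text \<open>Congruence modulo a power of \<open>p\<close> inside the ring of \<open>p\<close>-integral rationals. The library
  congruence is of no use here, since it is trivial on the field of rationals. Both sides are
  required to be \<open>p\<close>-integral.\<close>

definition p_cong :: "nat \<Rightarrow> nat \<Rightarrow> rat \<Rightarrow> rat \<Rightarrow> bool" where
  "p_cong p m a b \<longleftrightarrow> a \<in> p_integers p \<and> b \<in> p_integers p \<and>
     (\<exists>c\<in>p_integers p. a - b = of_nat p ^ m * c)"

definition p_residue :: "nat \<Rightarrow> rat \<Rightarrow> nat" where
  "p_residue p x = (THE r. r < p \<and> p_cong p 1 x (of_nat r))"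

definition V :: "nat \<Rightarrow> rat \<Rightarrow> rat" where
  "V n x = (\<Sum>k=0..n. of_nat (n choose k) * of_nat ((n + k) choose k) * (- 1) ^ k
              * (x gchoose k) * ((- 1 - x) gchoose k))"

definition V3 :: "nat \<Rightarrow> rat" where
  "V3 n = 27 ^ n * V n (- 1 / 3)"

definition V4 :: "nat \<Rightarrow> rat" where
  "V4 n = 64 ^ n * V n (- 1 / 4)"

definition V6 :: "nat \<Rightarrow> rat" where
  "V6 n = 432 ^ n * V n (- 1 / 6)"

fun euler_num :: "nat \<Rightarrow> int" where
  "euler_num n =
     (if n = 0 then 1 else if odd n then 0
      else - (\<Sum>k=1..n div 2. int (n choose (2 * k)) * euler_num (n - 2 * k)))"

fun U_num :: "nat \<Rightarrow> int" where
  "U_num n =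
     (if n = 0 then 1 else if odd n then 0
      else - 2 * (\<Sum>k=1..n div 2. int (n choose (2 * k)) * U_num (n - 2 * k)))"

text \<open>The truncated exponent is harmless: \<open>2 * n - 1 - 2 * k \<ge> 1\<close> for \<open>k < n\<close>.\<close>

fun s_num :: "nat \<Rightarrow> int" where
  "s_num n =
     (if n = 0 then 1
      else 1 - (\<Sum>k\<in>{..<n}. int (n choose k) * 2 ^ (2 * n - 1 - 2 * k) * s_num k))"

text \<open>As rewrite rules the defining equations would unfold without end.\<close>

declare euler_num.simps [simp del] U_num.simps [simp del] s_num.simps [simp del]

definition euler_poly :: "nat \<Rightarrow> rat \<Rightarrow> rat" where
  "euler_poly n x =
     (\<Sum>k=0..n. of_nat (n choose k) * (2 * x - 1) ^ (n - k) * of_int (euler_num k)) / 2 ^ n"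

end

theory Submission
  imports Defs "HOL-Number_Theory.Residues" "HOL-Computational_Algebra.Formal_Power_Series"
begin

text \<open>
  Put \<open>a\<^sub>k(x) = (x gchoose k) ((-1-x) gchoose k)\<close>, so that
  \<open>V\<^sub>n(x) = \<Sum>\<^sub>k a\<^sub>k(n) a\<^sub>k(x)\<close>. Summing over \<open>n < p\<close> telescopes and turns the left-hand
  side into \<open>p F(x)\<close> with \<open>F(x) = \<Sum>\<^sub>k a\<^sub>k(x) \<Prod>\<^sub>i (1 - p\<^sup>2/i\<^sup>2)\<close>, \<open>k < p\<close>, \<open>i \<le> k\<close>. Since
  \<open>a\<^sub>k(x) + a\<^sub>k(x-1)\<close> is a difference of consecutive products \<open>\<Prod>\<^sub>i (1 - x\<^sup>2/i\<^sup>2)\<close>, summation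
  by parts gives \<open>x\<^sup>2 (F(x) + F(x-1)) = 2 p\<^sup>2 (y(y+1) + 1)\<close> modulo \<open>p\<^sup>3\<close> for \<open>x = r + p y\<close> with
  \<open>0 < r < p\<close>. The functional equation \<open>E\<^sub>n(z+1) + E\<^sub>n(z) = 2 z\<^sup>n\<close> and Fermat's theorem show that
  \<open>(-1)\<^sup>r + p\<^sup>2 (y(y+1) + 1) E\<^sub>p\<^sub>-\<^sub>3(-x)\<close> obeys the same recurrence in \<open>r\<close>, and both agree at
  \<open>r = 0\<close> by Wolstenholme's congruences. The three special cases are \<open>x = -1/d\<close> with
  \<open>d = 3, 4, 6\<close>, where generating functions evaluate \<open>E\<^sub>n(1/d)\<close>.
\<close>

section \<open>Euler polynomials\<close>

definition egf :: "(nat \<Rightarrow> rat) \<Rightarrow> rat fps" where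
  "egf f = Abs_fps (\<lambda>n. f n / fact n)"

lemma egf_nth [simp]: "fps_nth (egf f) n = f n / fact n"
  by (simp add: egf_def)

lemma egf_eq_iff: "egf f = egf g \<longleftrightarrow> f = g"
  by (auto simp: fps_eq_iff)

lemma egf_add: "egf f + egf g = egf (\<lambda>n. f n + g n)"
  by (simp add: fps_eq_iff add_divide_distrib)

lemma fps_exp_eq_egf: "fps_exp c = egf (\<lambda>n. c ^ n)"
  by (simp add: fps_eq_iff)

text \<open>Multiplication by e^(ct) is binomial convolution with the powers of \<open>c\<close>, so
  each recurrence below becomes a product identity of power series.\<close>

lemma egf_times_exp:
  "egf f * fps_exp c = egf (\<lambda>n. \<Sum>k\<le>n. of_nat (n choose k) * f k * c ^ (n - k))"
proof (rule fps_ext)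
  fix n
  have "fps_nth (egf f * fps_exp c) n = (\<Sum>k\<le>n. f k / fact k * (c ^ (n - k) / fact (n - k)))"
    by (simp add: fps_mult_nth atMost_atLeast0)
  also have "\<dots> = (\<Sum>k\<le>n. of_nat (n choose k) * f k * c ^ (n - k)) / fact n"
    unfolding sum_divide_distrib
    by (intro sum.cong) (auto simp: binomial_fact field_simps)
  finally show "fps_nth (egf f * fps_exp c) n =
      fps_nth (egf (\<lambda>n. \<Sum>k\<le>n. of_nat (n choose k) * f k * c ^ (n - k))) n" by simp
qed

section \<open>Generating functions of the three integer sequences\<close>

lemma sum_even_binomial:
  fixes f :: "nat \<Rightarrow> int"
  assumes "even n" "\<And>k. odd k \<Longrightarrow> f k = 0"
  shows "(\<Sum>k=1..n div 2. int (n choose (2 * k)) * f (n - 2 * k)) = (\<Sum>k<n. int (n choose k) * f k)"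
proof -
  have "(\<Sum>k<n. int (n choose k) * f k) = (\<Sum>k\<in>{k. k < n \<and> even k}. int (n choose k) * f k)"
    by (intro sum.mono_neutral_right) (auto simp: assms(2))
  \<comment> \<open>The recurrences for \<open>euler_num\<close> and \<open>U_num\<close> step down
    from \<open>n\<close> by even amounts; the substitution k -> n - 2k turns them into full
    binomial sums, odd indices contributing nothing.\<close>
  also have "\<dots> = (\<Sum>k=1..n div 2. int (n choose (2 * k)) * f (n - 2 * k))"
    using \<open>even n\<close>
    by (intro sum.reindex_bij_witness[of _ "\<lambda>k. n - 2 * k" "\<lambda>k. (n - k) div 2"])
      (auto elim!: evenE simp: binomial_symmetric[symmetric] simp flip: right_diff_distrib')
  finally show ?thesis by simp
qed

lemma euler_num_odd: "odd n \<Longrightarrow> euler_num n = 0"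
  by (subst euler_num.simps) (auto intro: odd_pos)

lemma euler_num_0: "euler_num 0 = 1"
  by (subst euler_num.simps) simp

lemma euler_num_sum:
  assumes "even n" "n > 0"
  shows "(\<Sum>k\<le>n. int (n choose k) * euler_num k) = 0"
proof -
  have "euler_num n = - (\<Sum>k<n. int (n choose k) * euler_num k)"
    using assms sum_even_binomial[of n euler_num, OF _ euler_num_odd]
    by (subst euler_num.simps) auto
  then show ?thesis by (simp add: lessThan_Suc_atMost[symmetric])
qed

lemma U_num_odd: "odd n \<Longrightarrow> U_num n = 0"
  by (subst U_num.simps) (auto intro: odd_pos)

lemma U_num_0: "U_num 0 = 1"
  by (subst U_num.simps) simp

lemma U_num_sum:
  assumes "even n" "n > 0"
  shows "2 * (\<Sum>k\<le>n. int (n choose k) * U_num k) = U_num n"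
proof -
  have "U_num n = - 2 * (\<Sum>k<n. int (n choose k) * U_num k)"
    using assms sum_even_binomial[of n U_num, OF _ U_num_odd]
    by (subst U_num.simps) auto
  then show ?thesis by (simp add: lessThan_Suc_atMost[symmetric])
qed

text \<open>Up to the factor n!, this is coefficient \<open>n\<close> of the generating function of
  c^k f(k) times 2 cosh(ct). The powers of \<open>c\<close> and \<open>- c\<close> cancel when n - k
  is odd, and \<open>f\<close> lives on even indices, so only even \<open>n\<close>
  survives.\<close>

lemma even_binomial_convolution:
  fixes f :: "nat \<Rightarrow> int" and c :: rat
  assumes "\<And>k. odd k \<Longrightarrow> f k = 0"
  shows "(\<Sum>k\<le>n. of_nat (n choose k) * (c ^ k * of_int (f k)) * c ^ (n - k))
      + (\<Sum>k\<le>n. of_nat (n choose k) * (c ^ k * of_int (f k)) * (- c) ^ (n - k))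
    = (if even n then 2 * c ^ n * of_int (\<Sum>k\<le>n. int (n choose k) * f k) else 0)"
proof -
  have "of_nat (n choose k) * (c ^ k * of_int (f k)) * c ^ (n - k)
      + of_nat (n choose k) * (c ^ k * of_int (f k)) * (- c) ^ (n - k)
    = (if even n then 2 * c ^ n * of_int (int (n choose k) * f k) else 0)" if "k \<le> n" for k
  proof (cases "odd k")
    case True
    then show ?thesis by (simp add: assms)
  next
    case False
    have "c ^ k * c ^ (n - k) = c ^ n" using that by (simp flip: power_add)
    then show ?thesis using False that
      by (cases "even n") (auto simp: mult.commute mult.left_commute)
  qed
  then show ?thesis
    unfolding sum.distrib[symmetric]
    by (subst sum.cong[OF refl]) (auto simp: sum_distrib_left)
qed

lemma fps_exp_inverse: "fps_exp c * fps_exp (- c :: rat) = 1"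
  by (simp flip: fps_exp_add_mult)

text \<open>The constant coefficient is 2. Power series over the rationals form an integral domain,
  so the common denominator e^(ct) + 1 can be cancelled.\<close>

lemma fps_exp_plus_1_nonzero: "fps_exp c + 1 \<noteq> (0 :: rat fps)"
proof
  assume "fps_exp c + 1 = 0"
  then have "fps_nth (fps_exp c + 1) 0 = 0" by simp
  then show False by simp
qed

text \<open>The generating function of the Euler numbers is sech, here with its argument scaled by
  \<open>c\<close>.\<close>

lemma egf_euler_num:
  "egf (\<lambda>n. c ^ n * of_int (euler_num n)) * (fps_exp c + fps_exp (- c)) = 2"
proof -
  have "(\<Sum>k\<le>n. of_nat (n choose k) * (c ^ k * of_int (euler_num k)) * c ^ (n - k))
      + (\<Sum>k\<le>n. of_nat (n choose k) * (c ^ k * of_int (euler_num k)) * (- c) ^ (n - k))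
    = (if n = 0 then 2 else 0)" (is "?l = ?r") for n
  proof -
    have "?l = (if even n then 2 * c ^ n * of_int (\<Sum>k\<le>n. int (n choose k) * euler_num k) else 0)"
      by (rule even_binomial_convolution[OF euler_num_odd])
    also have "\<dots> = ?r"
      using euler_num_sum[of n] by (auto simp: euler_num_0 simp del: of_int_sum)
    finally show ?thesis .
  qed
  then show ?thesis
    unfolding distrib_left egf_times_exp egf_add by (simp add: fps_eq_iff fps_numeral_nth)
qed

text \<open>In analytic terms, the generating function of \<open>U_num\<close> is 1 / (2 cosh t -
  1).\<close>

lemma egf_U_num:
  "egf (\<lambda>n. of_int (U_num n)) * (fps_exp 1 + fps_exp (- 1) - 1) = 1"
proof -
  have "(\<Sum>k\<le>n. of_nat (n choose k) * of_int (U_num k) * 1 ^ (n - k))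
      + (\<Sum>k\<le>n. of_nat (n choose k) * of_int (U_num k) * (- 1) ^ (n - k))
    = (of_int (U_num n) + (if n = 0 then 1 else 0) :: rat)" (is "?l = ?r") for n
  proof -
    have "?l = (if even n then 2 * of_int (\<Sum>k\<le>n. int (n choose k) * U_num k) else 0)"
      using even_binomial_convolution[of U_num n 1, OF U_num_odd] by simp
    also have "\<dots> = ?r"
    proof (cases "odd n \<or> n = 0")
      case True
      then show ?thesis by (auto simp: U_num_odd U_num_0 intro: odd_pos)
    next
      case False
      then show ?thesis
        using U_num_sum[of n, THEN arg_cong[of _ _ "of_int :: int \<Rightarrow> rat"]] by simp
    qed
    finally show ?thesis .
  qed
  then have "egf (\<lambda>n. of_int (U_num n)) * (fps_exp 1 + fps_exp (- 1))
      = egf (\<lambda>n. of_int (U_num n)) + 1"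
    unfolding distrib_left egf_times_exp egf_add by (simp add: fps_eq_iff)
  then show ?thesis by (simp add: algebra_simps)
qed

lemma egf_s_num:
  "egf (\<lambda>n. of_int (s_num n)) * (fps_exp 4 + 1) = 2 * fps_exp 1"
proof -
  have "(\<Sum>k\<le>n. of_nat (n choose k) * of_int (s_num k) * 4 ^ (n - k)) + of_int (s_num n) = (2 :: rat)" for n
  proof (cases "n = 0")
    case True
    then show ?thesis by (subst (1 2) s_num.simps) simp
  next
    case False
    \<comment> \<open>Doubling the recurrence turns its exponent 2n - 1 - 2k into 2(n - k), hence
      the powers of 4 that match \<open>fps_exp 4\<close>.\<close>
    have *: "int (n choose k) * 2 ^ (2 * n - 1 - 2 * k) * s_num k * 2
        = int (n choose k) * s_num k * 4 ^ (n - k)" if "k < n" for k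
    proof -
      have "2 ^ (2 * n - 1 - 2 * k) * (2 :: int) = 2 ^ Suc (2 * n - 1 - 2 * k)" by simp
      also have "Suc (2 * n - 1 - 2 * k) = 2 * (n - k)" using that by auto
      also have "(2 :: int) ^ (2 * (n - k)) = 4 ^ (n - k)" by (simp add: power_mult)
      finally show ?thesis by simp
    qed
    have "s_num n = 1 - (\<Sum>k<n. int (n choose k) * 2 ^ (2 * n - 1 - 2 * k) * s_num k)"
      using False by (subst s_num.simps) simp
    then have "2 * s_num n + (\<Sum>k<n. int (n choose k) * 2 ^ (2 * n - 1 - 2 * k) * s_num k * 2) = 2"
      by (simp flip: sum_distrib_right)
    then have "2 * s_num n + (\<Sum>k<n. int (n choose k) * s_num k * 4 ^ (n - k)) = 2"
      by (subst (asm) sum.cong[OF refl *]) auto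
    then have "(\<Sum>k\<le>n. int (n choose k) * s_num k * 4 ^ (n - k)) + s_num n = 2"
      by (simp add: lessThan_Suc_atMost[symmetric])
    from arg_cong[OF this, of "of_int :: int \<Rightarrow> rat"] show ?thesis by simp
  qed
  then show ?thesis
    by (simp add: distrib_left egf_times_exp egf_add)
      (simp add: fps_eq_iff numeral_fps_const)
qed

section \<open>Generating function and functional equations of the Euler polynomials\<close>

lemma egf_euler_poly:
  "egf (\<lambda>n. c ^ n * euler_poly n x) * (fps_exp c + 1) = 2 * fps_exp (c * x)"
proof -
  \<comment> \<open>\<open>T\<close> is sech(ct/2). The definition of \<open>euler_poly\<close> is
    the convolution form of \<open>T\<close> times e^(c(x - 1/2)t), and e^(ct) + 1 = 2 cosh(ct/2)
    e^(ct/2) then gives the classical generating function.\<close>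
  define T where "T = egf (\<lambda>n. (c / 2) ^ n * of_int (euler_num n))"
  have "c ^ n * euler_poly n x
     = (\<Sum>k\<le>n. of_nat (n choose k) * ((c / 2) ^ k * of_int (euler_num k)) * (c * x - c / 2) ^ (n - k))" for n
  proof -
    have "c ^ n * (of_nat (n choose k) * (2 * x - 1) ^ (n - k) * of_int (euler_num k) / 2 ^ n)
      = of_nat (n choose k) * ((c / 2) ^ k * of_int (euler_num k)) * (c * x - c / 2) ^ (n - k)"
      if "k \<le> n" for k
    proof -
      have "c * x - c / 2 = (c / 2) * (2 * x - 1)" by (simp add: field_simps)
      then have "(c * x - c / 2) ^ (n - k) = (c / 2) ^ (n - k) * (2 * x - 1) ^ (n - k)"
        by (metis power_mult_distrib)
      then have "of_nat (n choose k) * ((c / 2) ^ k * of_int (euler_num k)) * (c * x - c / 2) ^ (n - k)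
          = of_nat (n choose k) * of_int (euler_num k) * (2 * x - 1) ^ (n - k)
              * ((c / 2) ^ k * (c / 2) ^ (n - k))"
        by (simp only: mult_ac)
      also have "(c / 2) ^ k * (c / 2) ^ (n - k) = c ^ n / 2 ^ n"
        using that by (simp add: power_divide flip: power_add)
      finally show ?thesis by simp
    qed
    then show ?thesis
      unfolding euler_poly_def sum_divide_distrib sum_distrib_left atMost_atLeast0
      by (intro sum.cong) auto
  qed
  then have 1: "egf (\<lambda>n. c ^ n * euler_poly n x) = T * fps_exp (c * x - c / 2)"
    unfolding T_def egf_times_exp by simp
  have 2: "T * (fps_exp (c / 2) + fps_exp (- (c / 2))) = 2"
    unfolding T_def by (rule egf_euler_num)
  have 3: "fps_exp c + 1 = (fps_exp (c / 2) + fps_exp (- (c / 2))) * fps_exp (c / 2)"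
    by (simp add: distrib_right flip: fps_exp_add_mult)
  have 4: "fps_exp (c * x - c / 2) * fps_exp (c / 2) = fps_exp (c * x)"
    by (simp flip: fps_exp_add_mult)
  have "egf (\<lambda>n. c ^ n * euler_poly n x) * (fps_exp c + 1)
      = (T * (fps_exp (c / 2) + fps_exp (- (c / 2)))) * (fps_exp (c * x - c / 2) * fps_exp (c / 2))"
    unfolding 1 3 by (simp only: mult_ac)
  then show ?thesis unfolding 2 4 .
qed

text \<open>The previous identity at \<open>- c\<close>, multiplied by e^(ct) so that the
  denominator is again e^(ct) + 1. Adding the two identities later isolates the values of even
  index.\<close>

lemma egf_euler_poly_neg:
  "egf (\<lambda>n. (- c) ^ n * euler_poly n x) * (fps_exp c + 1) = 2 * fps_exp (c - c * x)"
proof -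
  have "fps_exp c + 1 = (fps_exp (- c) + 1) * fps_exp c"
    using fps_exp_inverse[of c] by (simp add: algebra_simps)
  then have "egf (\<lambda>n. (- c) ^ n * euler_poly n x) * (fps_exp c + 1)
      = (2 * fps_exp (- c * x)) * fps_exp c"
    using egf_euler_poly[of "- c" x] by (metis mult.assoc)
  also have "\<dots> = 2 * fps_exp (- c * x + c)" by (simp only: fps_exp_add_mult mult.assoc)
  also have "- c * x + c = c - c * x" by simp
  finally show ?thesis .
qed

text \<open>The numerators add up to 2 e^(xt) (e^t + 1), so the denominator cancels. This is the
  source of the recurrence in the residue of \<open>x\<close>.\<close>

lemma euler_poly_shift: "euler_poly n (x + 1) + euler_poly n x = 2 * x ^ n"
proof -
  have "egf (\<lambda>n. euler_poly n (x + 1) + euler_poly n x) * (fps_exp 1 + 1)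
     = 2 * fps_exp (x + 1) + 2 * fps_exp x"
    using egf_euler_poly[of 1 "x + 1"] egf_euler_poly[of 1 x]
    by (simp add: distrib_right flip: egf_add)
  also have "\<dots> = (fps_exp x + fps_exp x) * (fps_exp 1 + 1)"
    by (simp add: fps_exp_add_mult algebra_simps)
  also have "fps_exp x + fps_exp x = egf (\<lambda>n. 2 * x ^ n)"
    unfolding fps_exp_eq_egf egf_add by simp
  finally have "egf (\<lambda>n. euler_poly n (x + 1) + euler_poly n x) = egf (\<lambda>n. 2 * x ^ n)"
    using fps_exp_plus_1_nonzero by simp
  then show ?thesis unfolding egf_eq_iff by metis
qed

lemma euler_poly_reflect: "(- 1) ^ n * euler_poly n x = euler_poly n (1 - x)"
proof -
  have "egf (\<lambda>n. (- 1) ^ n * euler_poly n x) * (fps_exp 1 + 1)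
      = egf (\<lambda>n. 1 ^ n * euler_poly n (1 - x)) * (fps_exp 1 + 1)"
    unfolding egf_euler_poly_neg egf_euler_poly by simp
  then have "egf (\<lambda>n. (- 1) ^ n * euler_poly n x) = egf (\<lambda>n. euler_poly n (1 - x))"
    using fps_exp_plus_1_nonzero by simp
  then show ?thesis unfolding egf_eq_iff by metis
qed

text \<open>The shift gives E_n(1) = -E_n(0) for n > 0, and the reflection gives E_n(0) = E_n(1) for
  even \<open>n\<close>. The base case of the main induction takes n = p - 3.\<close>

lemma euler_poly_even_0:
  assumes "even n" "n > 0"
  shows "euler_poly n 0 = 0"
  using euler_poly_shift[of n 0] euler_poly_reflect[of n 0] assms by simp

section \<open>Values of Euler polynomials at 1/4, 1/3 and 1/6\<close>

lemma s_num_eq: "of_int (s_num n) = 4 ^ n * euler_poly n (1 / 4)"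
proof -
  have "egf (\<lambda>n. of_int (s_num n)) * (fps_exp 4 + 1)
      = egf (\<lambda>n. 4 ^ n * euler_poly n (1 / 4)) * (fps_exp 4 + 1)"
    unfolding egf_euler_poly egf_s_num by simp
  then have "egf (\<lambda>n. of_int (s_num n)) = egf (\<lambda>n. 4 ^ n * euler_poly n (1 / 4))"
    using fps_exp_plus_1_nonzero by simp
  then show ?thesis unfolding egf_eq_iff by metis
qed

text \<open>With X = e^t the series of \<open>U_num\<close> is (X^2 + X) / (X^3 + 1), while those of
  3^n E_n(1/3) and (-3)^n E_n(1/3) are 2X and 2X^2 over the same denominator. So twice the first is
  the sum of the others, and these agree at even \<open>n\<close>.\<close>

lemma U_num_eq:
  assumes "even n"
  shows "of_int (U_num n) = 3 ^ n * euler_poly n (1 / 3)"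
proof -
  define X Y U G G' :: "rat fps" where "X = fps_exp 1" and "Y = fps_exp (- 1)"
    and "U = egf (\<lambda>n. of_int (U_num n))"
    and "G = egf (\<lambda>n. 3 ^ n * euler_poly n (1 / 3))"
    and "G' = egf (\<lambda>n. (- 3) ^ n * euler_poly n (1 / 3))"
  have X3: "fps_exp 3 = X ^ 3" and X2: "fps_exp 2 = X ^ 2" unfolding X_def by (simp_all add: fps_exp_power_mult)
  have XY: "X * Y = 1" unfolding X_def Y_def by (rule fps_exp_inverse)
  have "U * (X + Y - 1) = 1" unfolding U_def X_def Y_def by (rule egf_U_num)
  \<comment> \<open>The factor comes from X (X + Y - 1) = X^2 - X + 1 and (X + 1)(X^2 - X + 1) = X^3
    + 1.\<close>
  then have "X * (X + 1) * (U * (X + Y - 1)) = X * (X + 1)" by simp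
  moreover have "X * (X + 1) * (U * (X + Y - 1)) = U * (X + 1) * (X\<^sup>2 + X * Y - X)"
    by (simp add: algebra_simps power2_eq_square)
  ultimately have 1: "U * (X ^ 3 + 1) = X * (X + 1)"
    unfolding XY by (simp add: algebra_simps power2_eq_square power3_eq_cube)
  have 2: "G * (X ^ 3 + 1) = 2 * X"
    using egf_euler_poly[of 3 "1 / 3"] unfolding G_def X3 by (simp add: X_def)
  have 3: "G' * (X ^ 3 + 1) = 2 * X ^ 2"
    using egf_euler_poly_neg[of 3 "1 / 3"] unfolding G'_def X3 by (simp add: X2)
  have "(U + U) * (X ^ 3 + 1) = (G + G') * (X ^ 3 + 1)"
    unfolding distrib_right[of U] distrib_right[of G] 1 2 3
    by (simp add: algebra_simps power2_eq_square)
  then have "U + U = G + G'" using fps_exp_plus_1_nonzero[of 3] unfolding X3 by simp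
  then have "of_int (U_num n) + of_int (U_num n)
      = 3 ^ n * euler_poly n (1 / 3) + (- 3) ^ n * euler_poly n (1 / 3)"
    unfolding U_def G_def G'_def egf_add egf_eq_iff by metis
  then show ?thesis using assms by simp
qed

text \<open>Over the denominator X^6 + 1 with X = e^t, sech t has numerator 2X^5 - 2X^3 + 2X and
  sech 3t has 2X^3. The cubes cancel, and what is left is the sum of the series of 6^n E_n(1/6) and
  (-6)^n E_n(1/6).\<close>

lemma euler_poly_sixth:
  assumes "even n"
  shows "2 * (6 ^ n * euler_poly n (1 / 6)) = (1 + 3 ^ n) * of_int (euler_num n)"
proof -
  define X Y T T' G G' :: "rat fps" where "X = fps_exp 1" and "Y = fps_exp (- 1)"
    and "T = egf (\<lambda>n. 1 ^ n * of_int (euler_num n))"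
    and "T' = egf (\<lambda>n. 3 ^ n * of_int (euler_num n))"
    and "G = egf (\<lambda>n. 6 ^ n * euler_poly n (1 / 6))"
    and "G' = egf (\<lambda>n. (- 6) ^ n * euler_poly n (1 / 6))"
  have Xk: "fps_exp 3 = X ^ 3" "fps_exp 5 = X ^ 5" "fps_exp 6 = X ^ 6" "fps_exp (- 3) = Y ^ 3"
    unfolding X_def Y_def by (simp_all add: fps_exp_power_mult)
  have XY: "X * Y = 1" unfolding X_def Y_def by (rule fps_exp_inverse)
  have "T * (X + Y) = 2" unfolding T_def X_def Y_def by (rule egf_euler_num)
  \<comment> \<open>Here X (X + Y) = X^2 + 1, which the cofactor X^4 - X^2 + 1 completes to X^6 +
    1.\<close>
  then have "X * (X ^ 4 - X ^ 2 + 1) * (T * (X + Y)) = X * (X ^ 4 - X ^ 2 + 1) * 2" by simp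
  moreover have "X * (X ^ 4 - X ^ 2 + 1) * (T * (X + Y)) = T * (X ^ 4 - X ^ 2 + 1) * (X ^ 2 + X * Y)"
    by (simp add: algebra_simps power2_eq_square)
  ultimately have "T * (X ^ 4 - X ^ 2 + 1) * (X ^ 2 + 1) = X * (X ^ 4 - X ^ 2 + 1) * 2"
    unfolding XY by metis
  moreover have "T * (X ^ 4 - X ^ 2 + 1) * (X ^ 2 + 1) = T * (X ^ 6 + 1)"
    by (simp add: algebra_simps eval_nat_numeral)
  ultimately have 1: "T * (X ^ 6 + 1) = 2 * X ^ 5 - 2 * X ^ 3 + 2 * X"
    by (simp add: algebra_simps eval_nat_numeral)
  have "T' * (X ^ 3 + Y ^ 3) = 2" unfolding T'_def Xk[symmetric] by (rule egf_euler_num)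
  then have "X ^ 3 * (T' * (X ^ 3 + Y ^ 3)) = X ^ 3 * 2" by simp
  moreover have "X ^ 3 * (T' * (X ^ 3 + Y ^ 3)) = T' * (X ^ 6 + (X * Y) ^ 3)"
    unfolding power_mult_distrib by (simp add: algebra_simps eval_nat_numeral)
  ultimately have 2: "T' * (X ^ 6 + 1) = 2 * X ^ 3" unfolding XY by simp
  have 3: "G * (X ^ 6 + 1) = 2 * X"
    using egf_euler_poly[of 6 "1 / 6"] unfolding G_def Xk by (simp add: X_def)
  have 4: "G' * (X ^ 6 + 1) = 2 * X ^ 5"
    using egf_euler_poly_neg[of 6 "1 / 6"] unfolding G'_def Xk by (simp add: Xk)
  have "(G + G') * (X ^ 6 + 1) = (T + T') * (X ^ 6 + 1)"
    unfolding distrib_right[of G] distrib_right[of T] 1 2 3 4 by simp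
  then have "G + G' = T + T'" using fps_exp_plus_1_nonzero[of 6] unfolding Xk by simp
  then have "6 ^ n * euler_poly n (1 / 6) + (- 6) ^ n * euler_poly n (1 / 6)
     = 1 ^ n * of_int (euler_num n) + 3 ^ n * of_int (euler_num n)"
    unfolding T_def T'_def G_def G'_def egf_add egf_eq_iff by metis
  then show ?thesis using assms by (simp add: algebra_simps)
qed

section \<open>Binomial identities\<close>

definition binom_term :: "nat \<Rightarrow> rat \<Rightarrow> rat" where
  "binom_term k x = (x gchoose k) * ((- 1 - x) gchoose k)"

text \<open>A truncation of Euler's product for sin(pi x) / (pi x).\<close>

definition sine_prod :: "nat \<Rightarrow> rat \<Rightarrow> rat" where
  "sine_prod m x = (\<Prod>i=1..m. 1 - x\<^sup>2 / (of_nat i)\<^sup>2)"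

lemma sine_prod_0 [simp]: "sine_prod 0 x = 1"
  by (simp add: sine_prod_def)

lemma sine_prod_Suc: "sine_prod (Suc m) x = sine_prod m x * (1 - x\<^sup>2 / (of_nat (Suc m))\<^sup>2)"
  by (simp add: sine_prod_def)

lemma sine_prod_minus [simp]: "sine_prod m (- x) = sine_prod m x"
  by (simp add: sine_prod_def)

lemma binom_term_0 [simp]: "binom_term 0 x = 1"
  by (simp add: binom_term_def)

lemma binom_term_reflect: "binom_term k (- 1 - x) = binom_term k x"
  by (simp add: binom_term_def mult.commute)

lemma gchoose_Suc: "x gchoose Suc k = (x gchoose k) * (x - of_nat k) / (of_nat (Suc k) :: rat)"
  by (simp add: gbinomial_prod_rev atLeast0LessThan lessThan_Suc algebra_simps)

text \<open>In the product of the two falling factorials x - i pairs with x + i for i = 1, ..., k;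
  only x and x + k + 1 stay unpaired.\<close>

lemma binom_term_Suc:
  "binom_term (Suc k) x = - (x * (x + of_nat (Suc k)) / (of_nat (Suc k))\<^sup>2) * sine_prod k x"
proof (induction k)
  case 0
  show ?case by (simp add: binom_term_def gchoose_Suc algebra_simps)
next
  case (Suc k)
  define m :: rat where "m = of_nat (Suc k)"
  have m: "m > 0" "of_nat (Suc (Suc k)) = m + 1" by (auto simp: m_def)
  have "binom_term (Suc (Suc k)) x
      = binom_term (Suc k) x * ((x - m) * (- 1 - x - m)) / (m + 1)\<^sup>2"
    unfolding binom_term_def gchoose_Suc[of _ "Suc k"] m m_def[symmetric]
    by (simp add: power2_eq_square)
  also have "\<dots> = - (x * (x + m) / m\<^sup>2) * sine_prod k x * ((x - m) * (- 1 - x - m)) / (m + 1)\<^sup>2"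
    unfolding Suc.IH m_def ..
  also have "\<dots> = - (x * (x + (m + 1)) / (m + 1)\<^sup>2) * (sine_prod k x * (1 - x\<^sup>2 / m\<^sup>2))"
  proof -
    have "1 - x\<^sup>2 / m\<^sup>2 = (m - x) * (x + m) / m\<^sup>2"
      using m(1) by (simp add: field_simps power2_eq_square)
    moreover have "(x - m) * (- 1 - x - m) = (m - x) * (x + (m + 1))"
      by (simp add: algebra_simps)
    ultimately show ?thesis by (simp add: mult_ac)
  qed
  finally show ?case unfolding sine_prod_Suc m m_def[symmetric] .
qed

text \<open>By reflection the second summand is the first one at -x. The sine product is even, and
  x(x + m) + x(x - m) = 2x^2 with m = k + 1 leaves a difference of consecutive sine
  products.\<close>

lemma binom_term_add:
  "binom_term (Suc k) x + binom_term (Suc k) (x - 1) = 2 * (sine_prod (Suc k) x - sine_prod k x)"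
proof -
  define m :: rat where "m = of_nat (Suc k)"
  have "m > 0" by (simp add: m_def)
  have *: "binom_term (Suc k) (x - 1) = - (- x * (- x + of_nat (Suc k)) / (of_nat (Suc k))\<^sup>2) * sine_prod k (- x)"
    using binom_term_reflect[of "Suc k" "- x"] unfolding binom_term_Suc[of k "- x"] by simp
  show ?thesis
    unfolding * binom_term_Suc[of k x] sine_prod_Suc sine_prod_minus m_def[symmetric] using \<open>m > 0\<close>
    by (simp add: field_simps power2_eq_square)
qed

text \<open>Applying \<open>binom_term_Suc\<close> at x and at -(x + 1) gives two formulas for the
  same value. They show that the summands on the right are (x + 1 + k) and (x - k) times
  \<open>binom_term k x\<close>.\<close>

lemma binom_term_sine_prod:
  "(2 * x + 1) * binom_term k x = (x + 1) * sine_prod k (x + 1) + x * sine_prod k x"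
proof (cases k)
  case 0
  then show ?thesis by simp
next
  case (Suc j)
  define m :: rat where "m = of_nat k"
  have "m > 0" by (simp add: m_def Suc)
  have f: "1 - y\<^sup>2 / m\<^sup>2 = (m - y) * (m + y) / m\<^sup>2" for y
    using \<open>m > 0\<close> by (simp add: field_simps power2_eq_square)
  have f': "1 - y\<^sup>2 / m\<^sup>2 = - ((y - m) * (y + m) / m\<^sup>2)" for y
    using \<open>m > 0\<close> by (simp add: field_simps power2_eq_square)
  have g: "- (- z * (- z + m) / m\<^sup>2) = z * (m - z) / m\<^sup>2" for z by simp
  have 1: "binom_term k x = - (x * (x + m) / m\<^sup>2) * sine_prod j x"
    unfolding Suc binom_term_Suc m_def ..
  have "- 1 - x = - (x + 1)" by simp
  then have "binom_term k x = binom_term k (- (x + 1))" using binom_term_reflect[of k x] by metis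
  also have "\<dots> = - (- (x + 1) * (- (x + 1) + m) / m\<^sup>2) * sine_prod j (x + 1)"
    unfolding Suc binom_term_Suc sine_prod_minus m_def ..
  finally have 2: "binom_term k x = (x + 1) * (m - (x + 1)) / m\<^sup>2 * sine_prod j (x + 1)"
    unfolding g .
  have 3: "x * sine_prod k x = (x - m) * binom_term k x"
    unfolding 1 unfolding Suc sine_prod_Suc unfolding f' m_def[symmetric] Suc[symmetric]
    by (simp add: mult_ac add_ac)
  have 4: "(x + 1) * sine_prod k (x + 1) = (x + 1 + m) * binom_term k x"
    unfolding 2 unfolding Suc sine_prod_Suc unfolding f m_def[symmetric] Suc[symmetric]
    by (simp add: mult_ac add_ac)
  show ?thesis unfolding 3 4 by (simp add: algebra_simps)
qed

text \<open>The factor 2n + 1 splits each term into quantities belonging to n + 1 and n, and the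
  alternating sign makes them telescope; the lower boundary term has the factor 0.\<close>

lemma sum_binom_term_of_nat:
  "(\<Sum>n<N. of_nat (2 * n + 1) * (- 1) ^ n * binom_term k (of_nat n))
    = (- 1) ^ Suc N * of_nat N * sine_prod k (of_nat N)"
proof (induction N)
  case (Suc N)
  have "of_nat (2 * N + 1) * binom_term k (of_nat N)
      = of_nat (Suc N) * sine_prod k (of_nat (Suc N)) + of_nat N * sine_prod k (of_nat N)"
    using binom_term_sine_prod[of "of_nat N" k] by (simp add: add.commute)
  then have "of_nat (2 * N + 1) * (- 1) ^ N * binom_term k (of_nat N)
      = (- 1) ^ N * (of_nat (Suc N) * sine_prod k (of_nat (Suc N)) + of_nat N * sine_prod k (of_nat N))"
    by (metis mult.assoc mult.commute)
  then show ?case using Suc.IH by (simp add: algebra_simps)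
qed simp

text \<open>Upper negation of the second binomial. It exhibits \<open>V n x\<close> as a symmetric
  pairing of the values of \<open>binom_term\<close> at \<open>n\<close> and at
  \<open>x\<close>.\<close>

lemma binom_term_of_nat:
  "binom_term k (of_nat n) = of_nat (n choose k) * of_nat ((n + k) choose k) * (- 1) ^ k"
proof -
  have "(- 1 - of_nat n :: rat) gchoose k = (- 1) ^ k * (of_nat (n + k) gchoose k)"
    using gbinomial_minus[of "of_nat n + 1 :: rat" k] by (simp add: algebra_simps)
  then show ?thesis by (simp add: binom_term_def binomial_gbinomial)
qed

text \<open>For \<open>N\<close> = \<open>p\<close> this is the sum F of the outline.\<close>

definition twisted_sum :: "nat \<Rightarrow> rat \<Rightarrow> rat" where
  "twisted_sum N x = (\<Sum>k<N. binom_term k x * sine_prod k (of_nat N))"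

lemma sum_V:
  "(\<Sum>n<N. of_nat (2 * n + 1) * (- 1) ^ n * V n x) = (- 1) ^ Suc N * of_nat N * twisted_sum N x"
proof -
  have "V n x = (\<Sum>k<N. binom_term k (of_nat n) * binom_term k x)" if "n < N" for n
  proof -
    have "V n x = (\<Sum>k=0..n. binom_term k (of_nat n) * binom_term k x)"
      unfolding V_def binom_term_of_nat by (simp add: binom_term_def mult.assoc)
    \<comment> \<open>Terms with k > n vanish because \<open>n choose k\<close> is 0. A range
      independent of \<open>n\<close> permits exchanging the two sums.\<close>
    also have "\<dots> = (\<Sum>k<N. binom_term k (of_nat n) * binom_term k x)"
      using that by (intro sum.mono_neutral_left) (auto simp: binom_term_of_nat)
    finally show ?thesis .
  qed
  then have "(\<Sum>n<N. of_nat (2 * n + 1) * (- 1) ^ n * V n x)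
     = (\<Sum>n<N. \<Sum>k<N. of_nat (2 * n + 1) * (- 1) ^ n * binom_term k (of_nat n) * binom_term k x)"
    by (simp add: sum_distrib_left mult.assoc)
  also have "\<dots> = (\<Sum>k<N. (\<Sum>n<N. of_nat (2 * n + 1) * (- 1) ^ n * binom_term k (of_nat n)) * binom_term k x)"
    unfolding sum_distrib_right by (rule sum.swap)
  also have "\<dots> = (\<Sum>k<N. (- 1) ^ Suc N * of_nat N * (binom_term k x * sine_prod k (of_nat N)))"
    unfolding sum_binom_term_of_nat by (simp add: mult_ac)
  finally show ?thesis unfolding twisted_sum_def sum_distrib_left .
qed

section \<open>Congruences in the ring of p-integers\<close>

lemma p_integers_iff:
  assumes "prime p"
  shows "x \<in> p_integers p \<longleftrightarrow> (\<exists>a b. \<not> int p dvd b \<and> x = of_int a / of_int b)"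
proof
  assume x: "x \<in> p_integers p"
  obtain a b where ab: "quotient_of x = (a, b)" by fastforce
  have "coprime b (int p)" using x ab by (simp add: p_integers_def)
  then have "\<not> int p dvd b"
    using assms not_coprimeI[of "int p" b "int p"] by auto
  then show "\<exists>a b. \<not> int p dvd b \<and> x = of_int a / of_int b"
    using quotient_of_div[OF ab] by blast
next
  assume "\<exists>a b. \<not> int p dvd b \<and> x = of_int a / of_int b"
  then obtain a b where b: "\<not> int p dvd b" and x: "x = of_int a / of_int b" by blast
  obtain n d where nd: "quotient_of x = (n, d)" by fastforce
  have d: "d > 0" and c: "coprime n d"
    using quotient_of_denom_pos[OF nd] quotient_of_coprime[OF nd] by auto
  have "b \<noteq> 0" using b by auto
  have "of_int a / of_int b = (of_int n / of_int d :: rat)"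
    using x quotient_of_div[OF nd] by simp
  then have "(of_int (a * d) :: rat) = of_int (n * b)"
    using d \<open>b \<noteq> 0\<close> by (simp add: field_simps)
  then have "a * d = n * b" by (simp only: of_int_eq_iff)
  \<comment> \<open>The reduced denominator divides every other one, so \<open>p\<close> cannot
    divide it.\<close>
  then have "d dvd n * b" by (metis dvd_triv_right)
  then have "d dvd b" using c by (simp add: coprime_commute coprime_dvd_mult_right_iff)
  then have "\<not> int p dvd d" using b dvd_trans by blast
  then have "coprime d (int p)"
    using assms by (metis coprime_commute prime_imp_coprime prime_nat_int_transfer)
  then show "x \<in> p_integers p" by (simp add: p_integers_def nd)
qed

context
  fixes p :: nat
  assumes prime_p: "prime p"
begin

lemma p_integers_of_int [simp, intro]: "of_int a \<in> p_integers p"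
  unfolding p_integers_iff[OF prime_p] using prime_p
  by (intro exI[of _ a] exI[of _ 1]) (auto simp: zdvd1_eq)

lemma p_integers_of_nat [simp, intro]: "of_nat a \<in> p_integers p"
  using p_integers_of_int[of "int a"] by simp

lemma p_integers_numeral [simp, intro]: "numeral a \<in> p_integers p"
  using p_integers_of_int[of "numeral a"] by simp

lemma p_integers_0 [simp, intro]: "0 \<in> p_integers p"
  using p_integers_of_int[of 0] by simp

lemma p_integers_1 [simp, intro]: "1 \<in> p_integers p"
  using p_integers_of_int[of 1] by simp

lemma p_integers_mult [simp, intro]:
  assumes "x \<in> p_integers p" "y \<in> p_integers p"
  shows "x * y \<in> p_integers p"
proof -
  obtain a b c d where "\<not> int p dvd b" "x = of_int a / of_int b"
      "\<not> int p dvd d" "y = of_int c / of_int d"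
    using assms unfolding p_integers_iff[OF prime_p] by blast
  then show ?thesis
    unfolding p_integers_iff[OF prime_p] using prime_p
    by (intro exI[of _ "a * c"] exI[of _ "b * d"]) (auto simp: prime_dvd_mult_iff)
qed

lemma p_integers_add [simp, intro]:
  assumes "x \<in> p_integers p" "y \<in> p_integers p"
  shows "x + y \<in> p_integers p"
proof -
  obtain a b c d where *: "\<not> int p dvd b" "x = of_int a / of_int b"
      "\<not> int p dvd d" "y = of_int c / of_int d"
    using assms unfolding p_integers_iff[OF prime_p] by blast
  then have "b \<noteq> 0" "d \<noteq> 0" by auto
  with * show ?thesis
    unfolding p_integers_iff[OF prime_p] using prime_p
    by (intro exI[of _ "a * d + c * b"] exI[of _ "b * d"])
      (auto simp: prime_dvd_mult_iff add_frac_eq)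
qed

lemma p_integers_uminus [simp, intro]: "x \<in> p_integers p \<Longrightarrow> - x \<in> p_integers p"
  using p_integers_mult[OF p_integers_of_int[of "- 1"]] by simp

lemma p_integers_diff [simp, intro]:
  "x \<in> p_integers p \<Longrightarrow> y \<in> p_integers p \<Longrightarrow> x - y \<in> p_integers p"
  using p_integers_add[of x "- y"] by simp

lemma p_integers_power [simp, intro]: "x \<in> p_integers p \<Longrightarrow> x ^ n \<in> p_integers p"
  by (induction n) auto

lemma p_integers_sum [intro]:
  "(\<And>i. i \<in> A \<Longrightarrow> f i \<in> p_integers p) \<Longrightarrow> sum f A \<in> p_integers p"
  by (induction A rule: infinite_finite_induct) auto

lemma p_integers_prod [intro]:
  "(\<And>i. i \<in> A \<Longrightarrow> f i \<in> p_integers p) \<Longrightarrow> prod f A \<in> p_integers p"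
  by (induction A rule: infinite_finite_induct) auto

lemma p_integers_divide_of_nat:
  assumes "x \<in> p_integers p" "\<not> p dvd n"
  shows "x / of_nat n \<in> p_integers p"
proof -
  have "1 / of_nat n \<in> p_integers p"
    unfolding p_integers_iff[OF prime_p] using assms(2)
    by (intro exI[of _ 1] exI[of _ "int n"]) auto
  from p_integers_mult[OF assms(1) this] show ?thesis by simp
qed

lemma p_integers_divide [intro]:
  assumes "x \<in> p_integers p" "0 < n" "n < p"
  shows "x / of_nat n \<in> p_integers p"
  using assms by (auto intro!: p_integers_divide_of_nat dest: dvd_imp_le)

lemma p_congI:
  assumes "a \<in> p_integers p" "b \<in> p_integers p" "c \<in> p_integers p" "a - b = of_nat p ^ m * c"
  shows "p_cong p m a b"
  using assms by (auto simp: p_cong_def)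

lemma p_congE:
  assumes "p_cong p m a b"
  obtains c where "c \<in> p_integers p" "a = b + of_nat p ^ m * c"
    "a \<in> p_integers p" "b \<in> p_integers p"
proof -
  obtain c where "c \<in> p_integers p" "a - b = of_nat p ^ m * c"
    "a \<in> p_integers p" "b \<in> p_integers p"
    using assms by (auto simp: p_cong_def)
  then show ?thesis using that[of c] by (simp add: algebra_simps)
qed

lemma p_cong_refl [intro]: "a \<in> p_integers p \<Longrightarrow> p_cong p m a a"
  by (rule p_congI[where c = 0]) auto

lemma p_cong_sym: "p_cong p m a b \<Longrightarrow> p_cong p m b a"
  by (erule p_congE) (rule p_congI[where c = "- c" for c], auto)

lemma p_cong_add: "p_cong p m a b \<Longrightarrow> p_cong p m c d \<Longrightarrow> p_cong p m (a + c) (b + d)"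
  by (elim p_congE) (rule p_congI[where c = "c + c'" for c c'], auto simp: algebra_simps)

lemma p_cong_trans [trans]: "p_cong p m a b \<Longrightarrow> p_cong p m b c \<Longrightarrow> p_cong p m a c"
  by (elim p_congE) (rule p_congI[where c = "c + c'" for c c'], auto simp: algebra_simps)

lemma p_cong_mult:
  assumes "p_cong p m a b" "p_cong p m c d"
  shows "p_cong p m (a * c) (b * d)"
proof -
  obtain e where e: "e \<in> p_integers p" "a = b + of_nat p ^ m * e" "a \<in> p_integers p" "b \<in> p_integers p"
    using assms(1) by (rule p_congE)
  obtain f where f: "f \<in> p_integers p" "c = d + of_nat p ^ m * f" "c \<in> p_integers p" "d \<in> p_integers p"
    using assms(2) by (rule p_congE)
  have "a * c - b * d = of_nat p ^ m * (e * c + b * f)"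
    using e(2) f(2) by (simp add: algebra_simps)
  then show ?thesis using e f by (intro p_congI[where c = "e * c + b * f"]) auto
qed

lemma p_cong_uminus: "p_cong p m a b \<Longrightarrow> p_cong p m (- a) (- b)"
  using p_cong_mult[of m "-1" "-1" a b] by auto

lemma p_cong_diff: "p_cong p m a b \<Longrightarrow> p_cong p m c d \<Longrightarrow> p_cong p m (a - c) (b - d)"
  using p_cong_add[of m a b "- c" "- d"] p_cong_uminus[of m c d] by simp

lemma p_cong_power: "p_cong p m a b \<Longrightarrow> p_cong p m (a ^ n) (b ^ n)"
  by (induction n) (auto intro: p_cong_mult)

lemma p_cong_sum:
  "(\<And>i. i \<in> A \<Longrightarrow> p_cong p m (f i) (g i)) \<Longrightarrow> p_cong p m (sum f A) (sum g A)"
  by (induction A rule: infinite_finite_induct) (auto intro: p_cong_add)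

lemma p_cong_prod:
  "(\<And>i. i \<in> A \<Longrightarrow> p_cong p m (f i) (g i)) \<Longrightarrow> p_cong p m (prod f A) (prod g A)"
  by (induction A rule: infinite_finite_induct) (auto intro: p_cong_mult)

text \<open>A factor p^j raises the modulus accordingly. Hence Euler polynomial values, which always
  occur with a power of \<open>p\<close>, are needed only modulo \<open>p\<close>.\<close>

lemma p_cong_scale:
  assumes "p_cong p m a b"
  shows "p_cong p (j + m) (of_nat p ^ j * a) (of_nat p ^ j * b)"
proof -
  obtain e where e: "e \<in> p_integers p" "a = b + of_nat p ^ m * e" "a \<in> p_integers p" "b \<in> p_integers p"
    using assms(1) by (rule p_congE)
  then show ?thesis
    by (intro p_congI[where c = e]) (auto simp: algebra_simps power_add)
qed

lemma p_cong_zero_iff: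
  "p_cong p m a 0 \<longleftrightarrow> (\<exists>c\<in>p_integers p. a = of_nat p ^ m * c)"
  by (auto simp: p_cong_def)

section \<open>Units, Fermat's theorem and residues of \<open>p\<close>-integral rationals\<close>

lemma p_unit:
  assumes "x \<in> p_integers p" "\<not> p_cong p 1 x 0"
  obtains z where "z \<in> p_integers p" "x * z = 1"
proof -
  obtain a b where ab: "\<not> int p dvd b" "x = of_int a / of_int b"
    using assms unfolding p_integers_iff[OF prime_p] by blast
  have "b \<noteq> 0" using ab by auto
  have na: "\<not> int p dvd a"
  proof
    assume "int p dvd a"
    then obtain k where "a = int p * k" by auto
    moreover have "of_int k / of_int b \<in> p_integers p"
      unfolding p_integers_iff[OF prime_p] using ab(1) by blast
    ultimately have "p_cong p 1 x 0"
      using ab(2) unfolding p_cong_zero_iff by (intro bexI[of _ "of_int k / of_int b"]) auto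
    then show False using assms(2) by blast
  qed
  then have "a \<noteq> 0" by auto
  have "of_int b / of_int a \<in> p_integers p"
    unfolding p_integers_iff[OF prime_p] using na by blast
  moreover have "x * (of_int b / of_int a) = 1"
    using ab \<open>a \<noteq> 0\<close> \<open>b \<noteq> 0\<close> by auto
  ultimately show ?thesis using that by blast
qed

lemma p_cong_cancel_unit:
  assumes "p_cong p m (u * a) (u * b)" "u \<in> p_integers p" "\<not> p_cong p 1 u 0"
    "a \<in> p_integers p" "b \<in> p_integers p"
  shows "p_cong p m a b"
proof -
  obtain z where z: "z \<in> p_integers p" "u * z = 1" using p_unit assms by blast
  have "p_cong p m (z * (u * a)) (z * (u * b))"
    using assms z by (intro p_cong_mult[of m z z]) auto
  moreover have "z * (u * c) = c" for c using z(2) by (metis mult.assoc mult.commute mult_1)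
  ultimately show ?thesis by simp
qed

lemma p_cong_of_nat_iff: "p_cong p 1 (of_nat a) (of_nat b) \<longleftrightarrow> [a = b] (mod p)"
proof
  assume "p_cong p 1 (of_nat a) (of_nat b)"
  then obtain c where c: "c \<in> p_integers p" "(of_nat a :: rat) = of_nat b + of_nat p ^ 1 * c"
    by (rule p_congE)
  obtain u v where uv: "\<not> int p dvd v" "c = of_int u / of_int v"
    using c(1) unfolding p_integers_iff[OF prime_p] by blast
  have "v \<noteq> 0" using uv by auto
  have "(of_int (v * (int a - int b)) :: rat) = of_int (int p * u)"
    using c(2) uv(2) \<open>v \<noteq> 0\<close> by (simp add: field_simps)
  then have "v * (int a - int b) = int p * u" by (simp only: of_int_eq_iff)
  then have "int p dvd v * (int a - int b)" by simp
  then have "int p dvd int a - int b"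
    using uv(1) prime_p by (simp add: prime_dvd_mult_iff)
  then show "[a = b] (mod p)"
    by (simp add: cong_iff_dvd_diff flip: cong_int_iff)
next
  assume "[a = b] (mod p)"
  then have "int p dvd int a - int b"
    by (simp add: cong_iff_dvd_diff flip: cong_int_iff)
  then obtain k where "int a - int b = int p * k" by auto
  then have "(of_int (int a - int b) :: rat) = of_int (int p * k)" by simp
  then show "p_cong p 1 (of_nat a) (of_nat b)"
    by (intro p_congI[where c = "of_int k"]) auto
qed

lemma p_cong_fermat:
  assumes "p_cong p 1 x (of_nat r)" "0 < r" "r < p"
  shows "p_cong p 1 (x ^ (p - 1)) 1"
proof -
  have "\<not> p dvd r" using assms by (auto dest: dvd_imp_le)
  then have "p_cong p 1 (of_nat (r ^ (p - 1))) (of_nat 1)"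
    unfolding p_cong_of_nat_iff using prime_p fermat_theorem by blast
  moreover have "p_cong p 1 (x ^ (p - 1)) (of_nat r ^ (p - 1))"
    using assms by (intro p_cong_power)
  ultimately show ?thesis using p_cong_trans by (metis of_nat_1 of_nat_power)
qed

lemma ex_p_residue:
  assumes "x \<in> p_integers p"
  shows "\<exists>r<p. p_cong p 1 x (of_nat r)"
proof -
  obtain a b where ab: "\<not> int p dvd b" "x = of_int a / of_int b"
    using assms unfolding p_integers_iff[OF prime_p] by blast
  have "b \<noteq> 0" using ab by auto
  have "coprime b (int p)"
    using ab(1) prime_p by (metis coprime_commute prime_imp_coprime prime_nat_int_transfer)
  then obtain c where c: "[b * c = 1] (mod int p)" using cong_solve_coprime_int by blast
  \<comment> \<open>The residue of a/b is \<open>a\<close> times the inverse \<open>c\<close> of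
    \<open>b\<close> modulo \<open>p\<close>.\<close>
  define r where "r = nat ((a * c) mod int p)"
  have p0: "p > 0" using prime_p prime_gt_0_nat by blast
  have r: "int r = (a * c) mod int p" unfolding r_def using p0 by simp
  have "[b * int r = b * (a * c)] (mod int p)" unfolding r by (simp add: cong_def mod_mult_right_eq)
  also have "b * (a * c) = a * (b * c)" by simp
  also have "[\<dots> = a * 1] (mod int p)" using c by (rule cong_scalar_left)
  finally have "int p dvd a - b * int r" by (simp add: cong_iff_dvd_diff dvd_diff_commute)
  then obtain k where k: "a - b * int r = int p * k" by auto
  have "(of_int a - of_int b * of_nat r :: rat) = of_int (a - b * int r)" by simp
  also have "\<dots> = of_nat p * of_int k" unfolding k by simp
  finally have "x - of_nat r = of_nat p ^ 1 * (of_int k / of_int b)"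
    using ab(2) \<open>b \<noteq> 0\<close> by (simp add: field_simps)
  moreover have "of_int k / of_int b \<in> p_integers p"
      unfolding p_integers_iff[OF prime_p] using ab(1) by blast
  ultimately have "p_cong p 1 x (of_nat r)" using assms by (intro p_congI) auto
  moreover have "r < p" using p0 r by (metis of_nat_less_iff pos_mod_bound of_nat_0_less_iff)
  ultimately show ?thesis by blast
qed

text \<open>Uniqueness of the residue, which the definite description in \<open>p_residue\<close>
  requires.\<close>

lemma p_residue_eqI:
  assumes "r < p" "p_cong p 1 x (of_nat r)"
  shows "p_residue p x = r"
  unfolding p_residue_def
proof (rule the_equality)
  fix s assume s: "s < p \<and> p_cong p 1 x (of_nat s)"
  then have "p_cong p 1 (of_nat s) (of_nat r)" using assms p_cong_sym p_cong_trans by blast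
  then have "[s = r] (mod p)" unfolding p_cong_of_nat_iff .
  then show "s = r" using s assms(1) by (simp add: cong_less_modulus_unique_nat)
qed (use assms in auto)

context
  assumes p_gt_3: "p > 3"
begin

section \<open>Sine products modulo powers of \<open>p\<close> and the recurrence for
  \<open>twisted_sum\<close>\<close>

lemma odd_p: "odd p"
  using prime_p p_gt_3 by (intro prime_odd_nat) auto

lemma not_p_dvd:
  assumes "0 < n" "n < p"
  shows "\<not> p dvd n"
  using assms by (auto dest: dvd_imp_le)

lemma p_nonunit_of_nat_iff: "p_cong p 1 (of_nat n) 0 \<longleftrightarrow> p dvd n"
  using p_cong_of_nat_iff[of n 0] by (simp add: cong_0_iff)

lemma p_integers_half_power: "x \<in> p_integers p \<Longrightarrow> x / 2 ^ n \<in> p_integers p"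
proof -
  assume x: "x \<in> p_integers p"
  have "\<not> p dvd 2" using p_gt_3 by (intro not_p_dvd) auto
  then have "\<not> p dvd 2 ^ n" using prime_dvd_power[OF prime_p] by blast
  from p_integers_divide_of_nat[OF x this] show ?thesis by simp
qed

lemma p_integers_square_divide:
  assumes "x \<in> p_integers p" "0 < n" "n < p"
  shows "x / (of_nat n)\<^sup>2 \<in> p_integers p"
  using p_integers_divide[OF p_integers_divide[OF assms] assms(2,3)]
  by (simp add: power2_eq_square)

lemma sine_prod_integral:
  assumes "x \<in> p_integers p" "m < p"
  shows "sine_prod m x \<in> p_integers p"
  unfolding sine_prod_def using assms
  by (intro p_integers_prod p_integers_diff p_integers_square_divide p_integers_power) auto

lemma binom_term_integral:
  assumes "x \<in> p_integers p" "k < p"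
  shows "binom_term k x \<in> p_integers p"
proof (cases k)
  case (Suc j)
  show ?thesis using assms unfolding Suc binom_term_Suc
    by (intro p_integers_mult p_integers_uminus p_integers_square_divide p_integers_add sine_prod_integral) auto
qed auto

lemma twisted_sum_integral:
  assumes "x \<in> p_integers p"
  shows "twisted_sum p x \<in> p_integers p"
  unfolding twisted_sum_def using assms
  by (intro p_integers_sum p_integers_mult binom_term_integral sine_prod_integral) auto

text \<open>Each factor is 1 - p^2 y^2 / i^2 with i prime to \<open>p\<close>.\<close>

lemma sine_prod_multiple:
  assumes "y \<in> p_integers p" "m < p"
  shows "p_cong p 2 (sine_prod m (of_nat p * y)) 1"
proof -
  have "p_cong p 2 (1 - (of_nat p * y)\<^sup>2 / (of_nat i)\<^sup>2) 1" if "i \<in> {1..m}" for i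
  proof -
    have "y\<^sup>2 / (of_nat i)\<^sup>2 \<in> p_integers p"
      using assms that by (intro p_integers_square_divide p_integers_power) auto
    moreover have "(1 - (of_nat p * y)\<^sup>2 / (of_nat i)\<^sup>2) - 1 = of_nat p ^ 2 * - (y\<^sup>2 / (of_nat i)\<^sup>2)"
      by (simp add: power_mult_distrib)
    ultimately show ?thesis using assms that
      by (intro p_congI[where c = "- (y\<^sup>2 / (of_nat i)\<^sup>2)"] p_integers_diff
          p_integers_square_divide p_integers_power) auto
  qed
  from p_cong_prod[of "{1..m}" 2 "\<lambda>i. 1 - (of_nat p * y)\<^sup>2 / (of_nat i)\<^sup>2" "\<lambda>_. 1", OF this]
  show ?thesis by (simp add: sine_prod_def)
qed

lemma sine_prod_p: "m < p \<Longrightarrow> p_cong p 2 (sine_prod m (of_nat p)) 1"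
  using sine_prod_multiple[of 1 m] by simp

text \<open>Summation by parts. Let P_k and Q_k be the sine products at \<open>x\<close> and at
  \<open>p\<close>. The boundary term is 2 P_m Q_m, and Q_(k-1) - Q_k = Q_(k-1) p^2 / k^2 with
  Q_(k-1) congruent to 1. The factor x^2 lets the remainder telescope, as x^2 P_(k-1) / k^2 =
  P_(k-1) - P_k.\<close>

lemma twisted_sum_partial_add:
  assumes x: "x \<in> p_integers p" and "m < p"
  shows "p_cong p 3 (x\<^sup>2 * (\<Sum>k<Suc m. (binom_term k x + binom_term k (x - 1)) * sine_prod k (of_nat p)))
    (2 * (x\<^sup>2 * sine_prod m x * sine_prod m (of_nat p) + of_nat p ^ 2 * (1 - sine_prod m x)))"
  using \<open>m < p\<close>
proof (induction m)
  case 0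
  then show ?case using x by (auto simp: mult.commute)
next
  case (Suc m)
  define P Q P' Q' M where "P = sine_prod m x" and "Q = sine_prod m (of_nat p :: rat)"
    and "P' = sine_prod (Suc m) x" and "Q' = sine_prod (Suc m) (of_nat p :: rat)"
    and "M = (of_nat (Suc m) :: rat)"
  define T where "T = (\<Sum>k<Suc m. (binom_term k x + binom_term k (x - 1)) * sine_prod k (of_nat p))"
  have P: "P' = P * (1 - x\<^sup>2 / M\<^sup>2)" and Q: "Q' = Q * (1 - of_nat p ^ 2 / M\<^sup>2)"
    unfolding P_def P'_def Q_def Q'_def M_def by (rule sine_prod_Suc)+
  have int: "P \<in> p_integers p" "P' \<in> p_integers p" "Q \<in> p_integers p" "Q' \<in> p_integers p"
      "x\<^sup>2 / M\<^sup>2 \<in> p_integers p"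
    using sine_prod_integral[OF x, of m] sine_prod_integral[OF x, of "Suc m"]
      sine_prod_integral[OF p_integers_of_nat, of m p] sine_prod_integral[OF p_integers_of_nat, of "Suc m" p]
      p_integers_square_divide[OF p_integers_power[OF x], of "Suc m" 2] Suc.prems
    unfolding P_def P'_def Q_def Q'_def M_def by simp_all
  have "p_cong p 2 Q 1" unfolding Q_def using Suc.prems by (intro sine_prod_p) simp
  then obtain c where c: "c \<in> p_integers p" "Q = 1 + of_nat p ^ 2 * c" "Q \<in> p_integers p" "1 \<in> p_integers p"
    by (rule p_congE)
  have IH: "p_cong p 3 (x\<^sup>2 * T) (2 * (x\<^sup>2 * P * Q + of_nat p ^ 2 * (1 - P)))"
    using Suc unfolding T_def P_def Q_def by simp
  \<comment> \<open>Since Q - 1 = p^2 c, the error made in one step is even a multiple of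
    p^4.\<close>
  have eq: "2 * (x\<^sup>2 * P * Q + of_nat p ^ 2 * (1 - P)) + x\<^sup>2 * (2 * (P' - P) * Q')
     - 2 * (x\<^sup>2 * P' * Q' + of_nat p ^ 2 * (1 - P')) = of_nat p ^ 3 * (2 * of_nat p * (x\<^sup>2 / M\<^sup>2) * P * c)"
  proof -
    have "2 * (x\<^sup>2 * P * Q + of_nat p ^ 2 * (1 - P)) + x\<^sup>2 * (2 * (P' - P) * Q')
     - 2 * (x\<^sup>2 * P' * Q' + of_nat p ^ 2 * (1 - P'))
      = 2 * (x\<^sup>2 * P * (Q - Q') - of_nat p ^ 2 * (P - P'))" by (simp add: algebra_simps)
    also have "Q - Q' = Q * (of_nat p ^ 2 / M\<^sup>2)" unfolding Q by (simp add: algebra_simps)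
    also have "P - P' = P * (x\<^sup>2 / M\<^sup>2)" unfolding P by (simp add: algebra_simps)
    also have "2 * (x\<^sup>2 * P * (Q * (of_nat p ^ 2 / M\<^sup>2)) - of_nat p ^ 2 * (P * (x\<^sup>2 / M\<^sup>2)))
        = 2 * (x\<^sup>2 / M\<^sup>2) * P * of_nat p ^ 2 * (Q - 1)"
      by (simp add: left_diff_distrib right_diff_distrib diff_divide_distrib mult_ac)
    also have "\<dots> = of_nat p ^ 3 * (2 * of_nat p * (x\<^sup>2 / M\<^sup>2) * P * c)"
      unfolding c(2) by (simp add: algebra_simps eval_nat_numeral)
    finally show ?thesis .
  qed
  have "p_cong p 3 (x\<^sup>2 * T + x\<^sup>2 * (2 * (P' - P) * Q'))
     (2 * (x\<^sup>2 * P * Q + of_nat p ^ 2 * (1 - P)) + x\<^sup>2 * (2 * (P' - P) * Q'))"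
    using int x by (intro p_cong_add[OF IH] p_cong_refl p_integers_mult p_integers_diff p_integers_power) auto
  also have "p_cong p 3 \<dots> (2 * (x\<^sup>2 * P' * Q' + of_nat p ^ 2 * (1 - P')))"
    using int c(1) x
    by (intro p_congI[OF _ _ _ eq] p_integers_mult p_integers_add p_integers_diff p_integers_power) auto
  also have "x\<^sup>2 * T + x\<^sup>2 * (2 * (P' - P) * Q')
     = x\<^sup>2 * (\<Sum>k<Suc (Suc m). (binom_term k x + binom_term k (x - 1)) * sine_prod k (of_nat p))"
    unfolding sum.lessThan_Suc[of _ "Suc m"] T_def[symmetric] binom_term_add P_def P'_def Q'_def
    by (simp add: distrib_left)
  finally show ?case unfolding P'_def Q'_def by blast
qed

lemma twisted_sum_add:
  assumes x: "x \<in> p_integers p"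
  shows "p_cong p 3 (x\<^sup>2 * (twisted_sum p x + twisted_sum p (x - 1)))
    (2 * (x\<^sup>2 * sine_prod (p - 1) x * sine_prod (p - 1) (of_nat p) + of_nat p ^ 2 * (1 - sine_prod (p - 1) x)))"
proof -
  have "twisted_sum p x + twisted_sum p (x - 1)
      = (\<Sum>k<Suc (p - 1). (binom_term k x + binom_term k (x - 1)) * sine_prod k (of_nat p))"
    using p_gt_3 by (simp add: twisted_sum_def distrib_right sum.distrib)
  then show ?thesis using twisted_sum_partial_add[OF x, of "p - 1"] p_gt_3 by simp
qed

text \<open>Modulo \<open>p\<close> the values x + i, and likewise x - i, for i from 1 to p - 1 run
  over all classes except that of \<open>r\<close>. The index removed is the one whose value is 0;
  \<open>g\<close> gives the representatives.\<close>

lemma prod_shift_residues: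
  assumes x: "p_cong p 1 x (of_nat r)" and r: "0 < r" "r < p"
  shows "p_cong p 1 (\<Prod>i\<in>{1..p-1} - {p - r}. x + of_nat i) (\<Prod>j\<in>{1..p-1} - {r}. of_nat j)"
    and "p_cong p 1 (\<Prod>i\<in>{1..p-1} - {r}. x - of_nat i) (\<Prod>j\<in>{1..p-1} - {r}. of_nat j)"
proof -
  define g where "g i = (if i < p - r then r + i else r + i - p)" for i
  have "p_cong p 1 (x + of_nat i) (of_nat (g i))" for i
  proof -
    have "p_cong p 1 (x + of_nat i) (of_nat r + of_nat i)"
      using x by (intro p_cong_add) auto
    also have "p_cong p 1 (of_nat r + of_nat i) (of_nat (g i))"
      unfolding of_nat_add[symmetric] p_cong_of_nat_iff using r
      by (auto simp: g_def cong_def le_mod_geq)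
    finally show ?thesis .
  qed
  then have "p_cong p 1 (\<Prod>i\<in>{1..p-1} - {p - r}. x + of_nat i) (\<Prod>i\<in>{1..p-1} - {p - r}. of_nat (g i))"
    by (intro p_cong_prod) auto
  also have "(\<Prod>i\<in>{1..p-1} - {p - r}. of_nat (g i)) = (\<Prod>j\<in>{1..p-1} - {r}. of_nat j :: rat)"
    using r by (intro prod.reindex_bij_witness[of _ "\<lambda>j. if j > r then j - r else j + p - r" g])
      (auto simp: g_def split: if_splits)
  finally show "p_cong p 1 (\<Prod>i\<in>{1..p-1} - {p - r}. x + of_nat i) (\<Prod>j\<in>{1..p-1} - {r}. of_nat j)"
    by blast
next
  \<comment> \<open>Subtraction from \<open>r\<close> modulo \<open>p\<close> is an involution on
    the remaining indices, so \<open>g\<close> is its own inverse.\<close>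
  define g where "g i = (if i < r then r - i else r + p - i)" for i
  have "p_cong p 1 (x - of_nat i) (of_nat (g i))" if "i \<in> {1..p-1} - {r}" for i
  proof -
    have "p_cong p 1 (x - of_nat i) (of_nat r - of_nat i)"
      using x by (intro p_cong_diff) auto
    also have "p_cong p 1 (of_nat r - of_nat i) (of_nat (g i))"
      using that r
      by (intro p_congI[where c = "if i < r then 0 else - 1"]) (auto simp: g_def of_nat_diff)
    finally show ?thesis by blast
  qed
  then have "p_cong p 1 (\<Prod>i\<in>{1..p-1} - {r}. x - of_nat i) (\<Prod>i\<in>{1..p-1} - {r}. of_nat (g i))"
    by (intro p_cong_prod) auto
  also have "(\<Prod>i\<in>{1..p-1} - {r}. of_nat (g i)) = (\<Prod>j\<in>{1..p-1} - {r}. of_nat j :: rat)"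
    using r by (intro prod.reindex_bij_witness[of _ g g]) (auto simp: g_def split: if_splits)
  finally show "p_cong p 1 (\<Prod>i\<in>{1..p-1} - {r}. x - of_nat i) (\<Prod>j\<in>{1..p-1} - {r}. of_nat j)"
    by blast
qed

text \<open>Clearing denominators turns each factor into -(x + i)(x - i), and the number p - 1 of
  signs is even.\<close>

lemma sine_prod_fact:
  "sine_prod (p - 1) x * (\<Prod>i=1..p-1. of_nat i)\<^sup>2 = (\<Prod>i=1..p-1. x + of_nat i) * (\<Prod>i=1..p-1. x - of_nat i)"
proof -
  have "sine_prod (p - 1) x * (\<Prod>i=1..p-1. of_nat i)\<^sup>2
      = (\<Prod>i=1..p-1. (1 - x\<^sup>2 / (of_nat i)\<^sup>2) * (of_nat i)\<^sup>2)"
    by (simp add: sine_prod_def prod.distrib prod_power_distrib)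
  also have "\<dots> = (\<Prod>i=1..p-1. - 1 * ((x + of_nat i) * (x - of_nat i)))"
    by (intro prod.cong refl) (auto simp: field_simps power2_eq_square)
  also have "\<dots> = (\<Prod>i=1..p-1. x + of_nat i) * (\<Prod>i=1..p-1. x - of_nat i)"
    using odd_p unfolding prod.distrib by (simp add: prod_constant)
  finally show ?thesis .
qed

text \<open>Exactly one linear factor of each product in \<open>sine_prod_fact\<close> is divisible
  by \<open>p\<close>: x + (p - r) = p(y + 1) and x - r = p y. The other factors of each product
  multiply to \<open>W\<close> modulo \<open>p\<close>, while (p - 1)! = r W.\<close>

lemma sine_prod_residue:
  assumes y: "y \<in> p_integers p" and r: "0 < r" "r < p" and x: "x = of_nat r + of_nat p * y"
  shows "p_cong p 3 ((of_nat r)\<^sup>2 * sine_prod (p - 1) x) (of_nat p ^ 2 * (y * (y + 1)))"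
proof -
  define A B W :: rat where "A = (\<Prod>i\<in>{1..p-1} - {p - r}. x + of_nat i)"
    and "B = (\<Prod>i\<in>{1..p-1} - {r}. x - of_nat i)"
    and "W = (\<Prod>j\<in>{1..p-1} - {r}. of_nat j)"
  have xr: "p_cong p 1 x (of_nat r)"
    using x y by (intro p_congI[where c = y]) auto
  have AB: "p_cong p 1 A W" "p_cong p 1 B W"
    unfolding A_def B_def W_def using prod_shift_residues[OF xr r] by auto
  have "(\<Prod>i=1..p-1. x + of_nat i) = (x + of_nat (p - r)) * A"
    unfolding A_def using r by (intro prod.remove) auto
  also have "x + of_nat (p - r) = of_nat p * (y + 1)"
    using r x by (simp add: of_nat_diff algebra_simps)
  finally have 1: "(\<Prod>i=1..p-1. x + of_nat i) = of_nat p * (y + 1) * A" .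
  have "(\<Prod>i=1..p-1. x - of_nat i) = (x - of_nat r) * B"
    unfolding B_def using r by (intro prod.remove) auto
  then have 2: "(\<Prod>i=1..p-1. x - of_nat i) = of_nat p * y * B"
    using x by simp
  have 3: "(\<Prod>i=1..p-1. of_nat i) = of_nat r * W"
    unfolding W_def using r by (intro prod.remove) auto
  have "W\<^sup>2 * ((of_nat r)\<^sup>2 * sine_prod (p - 1) x) = of_nat p ^ 2 * (y * (y + 1) * (A * B))"
    using sine_prod_fact[of x] unfolding 1 2 3 by (simp add: algebra_simps power2_eq_square)
  moreover have "p_cong p (2 + 1) (of_nat p ^ 2 * (y * (y + 1) * (A * B))) (of_nat p ^ 2 * (y * (y + 1) * (W * W)))"
    using AB y by (intro p_cong_scale p_cong_mult p_cong_refl) auto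
  ultimately have *: "p_cong p 3 (W\<^sup>2 * ((of_nat r)\<^sup>2 * sine_prod (p - 1) x)) (W\<^sup>2 * (of_nat p ^ 2 * (y * (y + 1))))"
    by (simp add: mult_ac power2_eq_square)
  \<comment> \<open>\<open>W\<close> is a product of positive integers below \<open>p\<close>, so
    its square is a unit and cancels.\<close>
  have "\<not> p dvd (\<Prod>j\<in>{1..p-1} - {r}. j)\<^sup>2"
    using prime_p by (auto simp: prime_dvd_power_iff prime_dvd_prod_iff dest!: dvd_imp_le)
  then have "\<not> p_cong p 1 (W\<^sup>2) 0"
    using p_nonunit_of_nat_iff[of "(\<Prod>j\<in>{1..p-1} - {r}. j)\<^sup>2"] by (simp add: W_def)
  moreover have "W \<in> p_integers p" unfolding W_def by auto
  moreover have "sine_prod (p - 1) x \<in> p_integers p"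
    unfolding x using y p_gt_3 by (intro sine_prod_integral) auto
  ultimately show ?thesis using * y by (elim p_cong_cancel_unit) auto
qed

text \<open>Modulo p^3 the term x^2 P Q contributes p^2 y(y + 1) and p^2 (1 - P) contributes p^2. As
  p^2 divides \<open>P\<close>, replacing r^2 by x^2 and \<open>Q\<close> by 1 costs nothing at this
  precision.\<close>

lemma twisted_sum_add_residue:
  assumes y: "y \<in> p_integers p" and r: "0 < r" "r < p" and x: "x = of_nat r + of_nat p * y"
  shows "p_cong p 3 (x\<^sup>2 * (twisted_sum p x + twisted_sum p (x - 1))) (2 * (of_nat p ^ 2 * (y * (y + 1) + 1)))"
proof -
  define P Q where "P = sine_prod (p - 1) x" and "Q = sine_prod (p - 1) (of_nat p :: rat)"
  define q where "q = (of_nat p :: rat)"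
  have "q \<noteq> 0" using p_gt_3 by (simp add: q_def)
  have xi: "x \<in> p_integers p" unfolding x using y by auto
  have Pi: "P \<in> p_integers p" unfolding P_def using xi p_gt_3 by (intro sine_prod_integral) auto
  have qi: "q \<in> p_integers p" unfolding q_def using prime_p by auto
  have unit: "\<not> p_cong p 1 ((of_nat r)\<^sup>2) 0"
    using p_nonunit_of_nat_iff[of "r\<^sup>2"] prime_p not_p_dvd[OF r] by (simp add: prime_dvd_power_iff)
  obtain d where d: "d \<in> p_integers p" "(of_nat r)\<^sup>2 * P = q ^ 2 * (y * (y + 1)) + q ^ 3 * d"
    using p_congE[OF sine_prod_residue[OF y r x]] unfolding P_def q_def by metis
  have "p_cong p 2 ((of_nat r)\<^sup>2 * P) ((of_nat r)\<^sup>2 * 0)"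
    using d qi Pi y
    by (intro p_congI[where c = "y * (y + 1) + q * d"])
      (auto simp: q_def algebra_simps eval_nat_numeral)
  then have "p_cong p 2 P 0"
    using unit Pi by (elim p_cong_cancel_unit) auto
  then obtain c where c: "c \<in> p_integers p" "P = q ^ 2 * c"
    using p_congE unfolding q_def by (metis add_0)
  have "q ^ 2 * ((of_nat r)\<^sup>2 * c) = q ^ 2 * (y * (y + 1) + q * d)"
    using d(2) unfolding c(2) by (simp add: algebra_simps eval_nat_numeral)
  then have rc: "(of_nat r)\<^sup>2 * c = y * (y + 1) + q * d" using \<open>q \<noteq> 0\<close> by simp
  \<comment> \<open>\<open>e\<close> is (x^2 - r^2) / p.\<close>
  define e where "e = 2 * of_nat r * y + q * y\<^sup>2"
  have e: "e \<in> p_integers p" "x\<^sup>2 = (of_nat r)\<^sup>2 + q * e"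
    using y qi unfolding e_def x q_def by (auto simp: algebra_simps power2_eq_square)
  have "p_cong p 2 Q 1" unfolding Q_def using p_gt_3 by (intro sine_prod_p) simp
  then obtain f where f: "f \<in> p_integers p" "Q = 1 + q ^ 2 * f" "Q \<in> p_integers p" "1 \<in> p_integers p"
    unfolding q_def by (rule p_congE)
  have "x\<^sup>2 * c = y * (y + 1) + q * (d + e * c)"
    unfolding e(2) distrib_right rc by (simp add: algebra_simps)
  then have "x\<^sup>2 * P = q ^ 2 * (y * (y + 1) + q * (d + e * c))"
    unfolding c(2) by (metis mult.left_commute)
  then have "2 * (x\<^sup>2 * P * Q + q ^ 2 * (1 - P)) - 2 * (q ^ 2 * (y * (y + 1) + 1))
    = q ^ 3 * (2 * ((d + e * c) + q * f * (y * (y + 1) + q * (d + e * c)) - q * c))"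
    unfolding f(2) c(2) by (simp add: algebra_simps eval_nat_numeral)
  then have "p_cong p 3 (2 * (x\<^sup>2 * P * Q + q ^ 2 * (1 - P))) (2 * (q ^ 2 * (y * (y + 1) + 1)))"
    using xi Pi f qi y c d e unfolding q_def
    by (intro p_congI[
          where c = "2 * ((d + e * c) + q * f * (y * (y + 1) + q * (d + e * c)) - q * c)"])
      (auto simp: q_def)
  with twisted_sum_add[OF xi] show ?thesis unfolding P_def Q_def q_def using p_cong_trans by blast
qed

section \<open>Wolstenholme's congruences and the base case\<close>

lemma p_cong_inverse_of_nat:
  assumes "p_cong p 1 (of_nat a) (of_nat b)" "\<not> p dvd a" "\<not> p dvd b"
  shows "p_cong p 1 (1 / of_nat a) (1 / of_nat b)"
proof -
  obtain c where c: "c \<in> p_integers p" "(of_nat a :: rat) = of_nat b + of_nat p ^ 1 * c"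
    using p_congE[OF assms(1)] by metis
  have ne: "(of_nat a :: rat) \<noteq> 0" "(of_nat b :: rat) \<noteq> 0" using assms by (auto intro: ccontr)
  have i: "1 / of_nat a \<in> p_integers p" "1 / of_nat b \<in> p_integers p"
    using assms by (auto intro!: p_integers_divide_of_nat)
  have "1 / of_nat a - 1 / of_nat b = (of_nat b - of_nat a) * (1 / of_nat a * (1 / of_nat b) :: rat)"
    using ne by (simp add: field_simps)
  also have "\<dots> = of_nat p ^ 1 * - (c * (1 / of_nat a * (1 / of_nat b)))"
    unfolding c(2) by (simp add: algebra_simps)
  finally show ?thesis using i c(1)
    by (intro p_congI[where c = "- (c * (1 / of_nat a * (1 / of_nat b)))"] p_integers_uminus p_integers_mult)
qed

text \<open>Doubling permutes the nonzero residues modulo \<open>p\<close>, so H, which is 4 times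
  the sum of the 1/(2i)^2, is congruent to 4H. Thus 3H vanishes modulo \<open>p\<close>, and 3 is a
  unit.\<close>

lemma sum_inverse_squares: "p_cong p 1 (\<Sum>i=1..p-1. (1 / of_nat i)\<^sup>2) 0"
proof -
  define H where "H = (\<Sum>i=1..p-1. (1 / of_nat i :: rat)\<^sup>2)"
  define g where "g i = (if 2 * i < p then 2 * i else 2 * i - p)" for i
  have Hi: "H \<in> p_integers p" unfolding H_def
    by (intro p_integers_sum p_integers_power p_integers_divide) auto
  have g: "0 < g i \<and> g i < p" if "i \<in> {1..p-1}" for i
  proof -
    have "2 * i \<noteq> p" using odd_p by auto
    then show ?thesis using that by (auto simp: g_def)
  qed
  have "p_cong p 1 ((1 / of_nat (2 * i))\<^sup>2) ((1 / of_nat (g i))\<^sup>2)" if "i \<in> {1..p-1}" for i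
  proof -
    have "p_cong p 1 (of_nat (2 * i)) (of_nat (g i))"
      unfolding p_cong_of_nat_iff by (auto simp: g_def cong_def le_mod_geq)
    moreover have "\<not> p dvd g i" using g[OF that] by (intro not_p_dvd) auto
    moreover have "\<not> p dvd i" using that by (intro not_p_dvd) auto
    moreover have "\<not> p dvd 2" using p_gt_3 by (intro not_p_dvd) auto
    ultimately show ?thesis using prime_p
      by (intro p_cong_power p_cong_inverse_of_nat) (auto simp: prime_dvd_mult_iff)
  qed
  then have "p_cong p 1 (\<Sum>i=1..p-1. (1 / of_nat (2 * i))\<^sup>2) (\<Sum>i=1..p-1. (1 / of_nat (g i))\<^sup>2)"
    by (intro p_cong_sum) auto
  then have "p_cong p 1 (4 * (\<Sum>i=1..p-1. (1 / of_nat (2 * i))\<^sup>2)) (4 * (\<Sum>i=1..p-1. (1 / of_nat (g i))\<^sup>2))"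
    by (intro p_cong_mult) auto
  moreover have "4 * (\<Sum>i=1..p-1. (1 / of_nat (2 * i))\<^sup>2) = H"
    unfolding H_def sum_distrib_left by (intro sum.cong) (auto simp: power2_eq_square)
  moreover have "(\<Sum>i=1..p-1. (1 / of_nat (g i))\<^sup>2) = H"
    unfolding H_def
  \<comment> \<open>The inverse of doubling: exactly one of j and j + p is even, because
    \<open>p\<close> is odd.\<close>
  proof (intro sum.reindex_bij_witness[of _ "\<lambda>j. if even j then j div 2 else (j + p) div 2" g])
    fix i assume "i \<in> {1..p-1}"
    then show "g i \<in> {1..p-1}" using g[of i] by auto
    show "(if even (g i) then g i div 2 else (g i + p) div 2) = i"
      using odd_p by (auto simp: g_def)
  next
    fix j assume "j \<in> {1..p-1}"
    then show "g (if even j then j div 2 else (j + p) div 2) = j"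
        "(if even j then j div 2 else (j + p) div 2) \<in> {1..p-1}"
      using odd_p by (auto simp: g_def elim!: oddE evenE)
  qed simp
  ultimately have "p_cong p 1 H (4 * H)" by simp
  then have "p_cong p 1 (4 * H - H) (H - H)"
    using Hi by (intro p_cong_diff) (auto intro: p_cong_sym)
  then have "p_cong p 1 (of_nat 3 * H) (of_nat 3 * 0)" by (simp add: algebra_simps)
  then have "p_cong p 1 H 0"
    using Hi p_nonunit_of_nat_iff[of 3] not_p_dvd[of 3] p_gt_3
    by (elim p_cong_cancel_unit) auto
  then show ?thesis unfolding H_def .
qed

text \<open>Pairing i with p - i gives 1/i + 1/(p - i) = p / (i(p - i)), and 1/(p - i) is -1/i
  modulo \<open>p\<close>. So 2H is -p times the sum of inverse squares modulo p^2.\<close>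

lemma sum_inverses: "p_cong p 2 (\<Sum>i=1..p-1. 1 / of_nat i) 0"
proof -
  define H where "H = (\<Sum>i=1..p-1. 1 / of_nat i :: rat)"
  have Hi: "H \<in> p_integers p" unfolding H_def
    by (intro p_integers_sum p_integers_divide) auto
  have "H = (\<Sum>i=1..p-1. 1 / of_nat (p - i) :: rat)"
    unfolding H_def using p_gt_3 by (subst sum.atLeastAtMost_rev) simp
  then have "2 * H = (\<Sum>i=1..p-1. 1 / of_nat i + 1 / of_nat (p - i))"
    by (simp add: H_def sum.distrib)
  also have "\<dots> = (\<Sum>i=1..p-1. of_nat p * (1 / of_nat i * (1 / of_nat (p - i))))"
    by (intro sum.cong) (auto simp: of_nat_diff field_simps)
  finally have eq: "2 * H = of_nat p ^ 1 * (\<Sum>i=1..p-1. 1 / of_nat i * (1 / of_nat (p - i)))"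
    by (simp add: sum_distrib_left)
  have "p_cong p 1 (1 / of_nat i * (1 / of_nat (p - i))) (1 / of_nat i * - (1 / of_nat i))"
    if "i \<in> {1..p-1}" for i
  proof -
    have i: "1 / of_nat i \<in> p_integers p" "1 / of_nat (p - i) \<in> p_integers p"
      using that by (auto intro!: p_integers_divide)
    have "1 / of_nat (p - i) - - (1 / of_nat i) = of_nat p ^ 1 * (1 / of_nat i * (1 / of_nat (p - i)) :: rat)"
      using that by (auto simp: of_nat_diff field_simps)
    then have "p_cong p 1 (1 / of_nat (p - i)) (- (1 / of_nat i))"
      using i by (intro p_congI[OF _ _ p_integers_mult[OF i]] p_integers_uminus)
    then show ?thesis using i by (intro p_cong_mult p_cong_refl) auto
  qed
  then have "p_cong p 1 (\<Sum>i=1..p-1. 1 / of_nat i * (1 / of_nat (p - i))) (\<Sum>i=1..p-1. 1 / of_nat i * - (1 / of_nat i))"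
    by (intro p_cong_sum) auto
  also have "(\<Sum>i=1..p-1. 1 / of_nat i * - (1 / of_nat i)) = - (\<Sum>i=1..p-1. (1 / of_nat i :: rat)\<^sup>2)"
    by (simp add: sum_negf power2_eq_square)
  also have "p_cong p 1 \<dots> (- 0)"
    using sum_inverse_squares by (intro p_cong_uminus)
  finally have "p_cong p (1 + 1) (2 * H) (of_nat p ^ 1 * (- 0))"
    unfolding eq by (intro p_cong_scale) auto
  then have "p_cong p 2 (of_nat 2 * H) (of_nat 2 * 0)" by (simp add: numeral_2_eq_2)
  then have "p_cong p 2 H 0"
    using Hi p_nonunit_of_nat_iff[of 2] not_p_dvd[of 2] p_gt_3
    by (elim p_cong_cancel_unit) auto
  then show ?thesis unfolding H_def .
qed

text \<open>For k > 0 the term is -(py/k)(py/k + 1) times sine products congruent to 1 modulo p^2;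
  the factor \<open>p\<close> in front makes this precise modulo p^3. The two harmonic sums vanish
  to the required order, leaving the term 1 of k = 0.\<close>

lemma twisted_sum_multiple:
  assumes y: "y \<in> p_integers p"
  shows "p_cong p 3 (twisted_sum p (of_nat p * y)) 1"
proof -
  define q where "q = (of_nat p :: rat)"
  have qi: "q \<in> p_integers p" unfolding q_def by auto
  have term_cong: "p_cong p 3 (binom_term k (q * y) * sine_prod k q) (- (q * y) * (1 / of_nat k) - q ^ 2 * y\<^sup>2 * (1 / of_nat k)\<^sup>2)"
    if k: "k \<in> {1..p-1}" for k
  proof -
    obtain j where j: "k = Suc j" using k by (cases k) auto
    define u :: rat where "u = 1 / of_nat k"
    have ui: "u \<in> p_integers p" unfolding u_def using k by (intro p_integers_divide) auto
    have uk: "u * of_nat k = 1" using k by (simp add: u_def)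
    have "p_cong p 2 (sine_prod j (q * y) * sine_prod k q) (1 * 1)"
      unfolding q_def using j k y by (intro p_cong_mult sine_prod_multiple sine_prod_p) auto
    then obtain c where c: "c \<in> p_integers p" "sine_prod j (q * y) * sine_prod k q = 1 + q ^ 2 * c"
      using p_congE unfolding q_def by (metis mult_1)
    have "binom_term k (q * y) = - (q * y * (q * y + of_nat k) * u\<^sup>2) * sine_prod j (q * y)"
      unfolding j binom_term_Suc u_def by (simp add: power_one_over)
    also have "q * y * (q * y + of_nat k) * u\<^sup>2 = q * y * u * (q * y * u + u * of_nat k)"
      by (simp add: algebra_simps power2_eq_square)
    finally have "binom_term k (q * y) * sine_prod k q
        = - (q * y * u * (q * y * u + 1)) * (sine_prod j (q * y) * sine_prod k q)"
      unfolding uk by (simp only: mult.assoc)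
    then have "binom_term k (q * y) * sine_prod k q - (- (q * y) * u - q ^ 2 * y\<^sup>2 * u\<^sup>2)
        = q ^ 3 * - (y * u * (q * y * u + 1) * c)"
      unfolding c(2) by (simp add: algebra_simps eval_nat_numeral)
    moreover have "binom_term k (q * y) * sine_prod k q \<in> p_integers p"
      using qi y k by (intro p_integers_mult binom_term_integral sine_prod_integral) auto
    ultimately show ?thesis unfolding u_def[symmetric] using c(1) ui y qi
      by (intro p_congI[where c = "- (y * u * (q * y * u + 1) * c)"]) (auto simp: q_def)
  qed
  have "{..<p} = insert 0 {1..p-1}" using p_gt_3 by auto
  then have "twisted_sum p (q * y) = 1 + (\<Sum>k=1..p-1. binom_term k (q * y) * sine_prod k q)"
    unfolding twisted_sum_def q_def by simp
  also have "p_cong p 3 \<dots> (1 + (\<Sum>k=1..p-1. - (q * y) * (1 / of_nat k) - q ^ 2 * y\<^sup>2 * (1 / of_nat k)\<^sup>2))"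
    using term_cong by (intro p_cong_add p_cong_refl p_cong_sum) auto
  also have "1 + (\<Sum>k=1..p-1. - (q * y) * (1 / of_nat k) - q ^ 2 * y\<^sup>2 * (1 / of_nat k)\<^sup>2)
      = 1 + (q ^ 1 * (- y * (\<Sum>k=1..p-1. 1 / of_nat k)) + q ^ 2 * (- (y\<^sup>2) * (\<Sum>k=1..p-1. (1 / of_nat k)\<^sup>2)))"
    unfolding sum_subtractf sum_distrib_left[symmetric] by simp
  also have "p_cong p 3 \<dots> (1 + (q ^ 1 * (- y * 0) + q ^ 2 * (- (y\<^sup>2) * 0)))"
    unfolding q_def
    using y p_cong_scale[OF p_cong_mult[OF _ sum_inverses], of "- y" "- y" 1]
      p_cong_scale[OF p_cong_mult[OF _ sum_inverse_squares], of "- (y\<^sup>2)" "- (y\<^sup>2)" 2]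
    by (intro p_cong_add p_cong_refl) (auto simp del: mult_minus_left simp: numeral_3_eq_3 numeral_2_eq_2)
  finally show ?thesis unfolding q_def by simp
qed

section \<open>Euler polynomials modulo powers of \<open>p\<close> and the main congruence\<close>

lemma euler_poly_cong:
  assumes "p_cong p m x z"
  shows "p_cong p m (euler_poly n x) (euler_poly n z)"
proof -
  \<comment> \<open>The only denominator is a power of 2, a unit because \<open>p\<close> is
    odd.\<close>
  have "p_cong p m ((\<Sum>k=0..n. of_nat (n choose k) * (2 * x - 1) ^ (n - k) * of_int (euler_num k)) * (1 / 2 ^ n))
     ((\<Sum>k=0..n. of_nat (n choose k) * (2 * z - 1) ^ (n - k) * of_int (euler_num k)) * (1 / 2 ^ n))"
    using assms
    by (intro p_cong_mult p_cong_sum p_cong_power p_cong_diff p_cong_refl p_integers_half_power) auto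
  then show ?thesis by (simp add: euler_poly_def)
qed

lemma euler_poly_integral: "x \<in> p_integers p \<Longrightarrow> euler_poly n x \<in> p_integers p"
  \<comment> \<open>With exponent 0 a congruence says just that both sides are
    \<open>p\<close>-integral.\<close>
  using euler_poly_cong[of 0 x x n] by (auto simp: p_cong_def)

text \<open>Induction on \<open>r\<close> with \<open>y\<close> fixed, so that x -> x - 1 lowers the
  residue. Both sides obey the same recurrence after multiplication by x^2, a unit as long as the
  residue is nonzero.\<close>

lemma twisted_sum_cong:
  assumes y: "y \<in> p_integers p" and "r < p"
  shows "p_cong p 3 (twisted_sum p (of_nat r + of_nat p * y))
    ((- 1) ^ r + of_nat p ^ 2 * ((y * (y + 1) + 1) * euler_poly (p - 3) (- (of_nat r + of_nat p * y))))"
  using \<open>r < p\<close>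
proof (induction r)
  case 0
  have "p_cong p 1 (- (of_nat p * y)) 0"
    using y by (intro p_congI[where c = "- y"]) auto
  then have "p_cong p 1 (euler_poly (p - 3) (- (of_nat p * y))) (euler_poly (p - 3) 0)"
    by (rule euler_poly_cong)
  also have "euler_poly (p - 3) 0 = 0"
    using odd_p p_gt_3 by (intro euler_poly_even_0) auto
  finally have "p_cong p (2 + 1) (of_nat p ^ 2 * ((y * (y + 1) + 1) * euler_poly (p - 3) (- (of_nat p * y))))
      (of_nat p ^ 2 * ((y * (y + 1) + 1) * 0))"
    using y by (intro p_cong_scale p_cong_mult p_cong_refl) auto
  then have "p_cong p 3 (1 + of_nat p ^ 2 * ((y * (y + 1) + 1) * euler_poly (p - 3) (- (of_nat p * y)))) (1 + 0)"
    by (intro p_cong_add p_cong_refl) auto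
  then show ?case
    using p_cong_trans[OF twisted_sum_multiple[OF y] p_cong_sym] by simp
next
  case (Suc r)
  define x z where "x = of_nat (Suc r) + of_nat p * y" and "z = y * (y + 1) + 1"
  define e where "e = euler_poly (p - 3)"
  have x1: "of_nat r + of_nat p * y = x - 1" by (simp add: x_def)
  have xr: "p_cong p 1 x (of_nat (Suc r))"
    using y by (intro p_congI[where c = y]) (auto simp: x_def)
  then have xi: "x \<in> p_integers p" by (simp add: p_cong_def)
  have zi: "z \<in> p_integers p" unfolding z_def using y by auto
  have ei: "e (- x) \<in> p_integers p" "e (- (x - 1)) \<in> p_integers p"
    unfolding e_def using xi by (auto intro!: euler_poly_integral)
  have Fi: "twisted_sum p x \<in> p_integers p" "twisted_sum p (x - 1) \<in> p_integers p"
    using xi by (auto intro!: twisted_sum_integral)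
  have IH: "p_cong p 3 (twisted_sum p (x - 1)) ((- 1) ^ r + of_nat p ^ 2 * (z * e (- (x - 1))))"
    using Suc unfolding x1 z_def e_def by simp
  have "e (- x + 1) + e (- x) = 2 * (- x) ^ (p - 3)"
    unfolding e_def by (rule euler_poly_shift)
  \<comment> \<open>Here p - 3 is even, so the sign of -x disappears.\<close>
  moreover have "(- x) ^ (p - 3) = x ^ (p - 3)" using odd_p p_gt_3 by (intro power_minus_even) auto
  ultimately have "x\<^sup>2 * (e (- x) + e (- (x - 1))) = 2 * (x\<^sup>2 * x ^ (p - 3))" by (simp add: algebra_simps)
  also have "x\<^sup>2 * x ^ (p - 3) = x ^ (p - 1)"
  proof -
    have "p - 1 = 2 + (p - 3)" using p_gt_3 by simp
    then show ?thesis by (simp only: power_add)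
  qed
  finally have sh: "x\<^sup>2 * (e (- x) + e (- (x - 1))) = 2 * x ^ (p - 1)" .
  \<comment> \<open>Fermat's theorem reduces 2 x^(p-1) to the constant 2 of
    \<open>twisted_sum_add_residue\<close>.\<close>
  have "p_cong p 1 (x ^ (p - 1)) 1"
    using Suc.prems by (intro p_cong_fermat[OF xr]) auto
  then have "p_cong p (2 + 1) (of_nat p ^ 2 * (z * (2 * x ^ (p - 1)))) (of_nat p ^ 2 * (z * (2 * 1)))"
    using zi by (intro p_cong_scale p_cong_mult p_cong_refl) auto
  then have "p_cong p 3 (2 * (of_nat p ^ 2 * z)) (x\<^sup>2 * (of_nat p ^ 2 * (z * (e (- x) + e (- (x - 1))))))"
    unfolding sh[symmetric] by (auto simp: mult_ac intro: p_cong_sym)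
  then have "p_cong p 3 (x\<^sup>2 * (twisted_sum p x + twisted_sum p (x - 1))) (x\<^sup>2 * (of_nat p ^ 2 * (z * (e (- x) + e (- (x - 1))))))"
    using twisted_sum_add_residue[OF y _ Suc.prems x_def] unfolding z_def[symmetric] using p_cong_trans by blast
  moreover have "\<not> p_cong p 1 (x\<^sup>2) 0"
  proof
    assume "p_cong p 1 (x\<^sup>2) 0"
    moreover have "p_cong p 1 (x\<^sup>2) ((of_nat (Suc r))\<^sup>2)"
      using xr by (intro p_cong_power) auto
    ultimately have "p_cong p 1 (of_nat ((Suc r)\<^sup>2)) 0"
      using p_cong_trans[OF p_cong_sym] by (metis of_nat_power)
    then show False unfolding p_nonunit_of_nat_iff
      using prime_p not_p_dvd[of "Suc r"] Suc.prems by (auto simp: prime_dvd_power_iff)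
  qed
  ultimately have "p_cong p 3 (twisted_sum p x + twisted_sum p (x - 1)) (of_nat p ^ 2 * (z * (e (- x) + e (- (x - 1)))))"
    using xi zi ei Fi by (elim p_cong_cancel_unit) auto
  from p_cong_diff[OF this IH]
  have "p_cong p 3 (twisted_sum p x) ((- 1) ^ Suc r + of_nat p ^ 2 * (z * e (- x)))"
    by (simp add: algebra_simps)
  then show ?case unfolding x_def z_def e_def .
qed

text \<open>The outer factor \<open>p\<close> in \<open>sum_V\<close> raises the modulus from p^3 to
  p^4, and its sign (-1)^(p+1) is 1 for odd \<open>p\<close>.\<close>

lemma sum_V_cong:
  assumes x: "x = of_nat r + of_nat p * y" and y: "y \<in> p_integers p" and "r < p"
  shows "p_cong p 4 (\<Sum>n=0..p-1. of_nat (2 * n + 1) * (- 1) ^ n * V n x)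
    ((- 1) ^ r * of_nat p + of_nat p ^ 3 * (y * (y + 1) + 1) * euler_poly (p - 3) (- x))"
proof -
  have "{0..p-1} = {..<p}" using p_gt_3 by auto
  then have "(\<Sum>n=0..p-1. of_nat (2 * n + 1) * (- 1) ^ n * V n x) = of_nat p ^ 1 * twisted_sum p x"
    using sum_V[where N = p and x = x] odd_p by simp
  moreover have "p_cong p (1 + 3) (of_nat p ^ 1 * twisted_sum p x) (of_nat p ^ 1 *
    ((- 1) ^ r + of_nat p ^ 2 * ((y * (y + 1) + 1) * euler_poly (p - 3) (- x))))"
    unfolding x using twisted_sum_cong[OF y \<open>r < p\<close>] by (intro p_cong_scale) auto
  moreover have "of_nat p ^ 1 *
    ((- 1) ^ r + of_nat p ^ 2 * ((y * (y + 1) + 1) * euler_poly (p - 3) (- x)))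
    = (- 1) ^ r * of_nat p + of_nat p ^ 3 * (y * (y + 1) + 1) * euler_poly (p - 3) (- x)"
    by (simp add: algebra_simps eval_nat_numeral)
  ultimately show ?thesis by simp
qed

text \<open>The Euler term carries the factor p^3, so modulo p^4 it may be replaced by anything
  congruent modulo \<open>p\<close>.\<close>

lemma p_cong_scaled_rhs:
  assumes "p_cong p 4 S (c + of_nat p ^ 3 * a)" "p_cong p 1 a b"
  shows "p_cong p 4 S (c + of_nat p ^ 3 * b)"
proof -
  have "c \<in> p_integers p"
  proof -
    have "c + of_nat p ^ 3 * a \<in> p_integers p" "a \<in> p_integers p"
      using assms by (auto simp: p_cong_def)
    then have "(c + of_nat p ^ 3 * a) - of_nat p ^ 3 * a \<in> p_integers p"
      by (intro p_integers_diff p_integers_mult p_integers_power) auto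
    then show ?thesis by simp
  qed
  then have "p_cong p 4 (c + of_nat p ^ 3 * a) (c + of_nat p ^ 3 * b)"
    using p_cong_scale[OF assms(2), of 3] by (intro p_cong_add p_cong_refl) auto
  with assms(1) show ?thesis by (rule p_cong_trans)
qed

section \<open>Evaluation at negative unit fractions\<close>

lemma p_cong_fermat_of_nat:
  assumes "\<not> p dvd d"
  shows "p_cong p 1 (of_nat d ^ (p - 1)) 1"
proof -
  have "p_cong p 1 (of_nat (d ^ (p - 1))) (of_nat 1)"
    unfolding p_cong_of_nat_iff using prime_p assms fermat_theorem by blast
  then show ?thesis by simp
qed

text \<open>The relation d r + 1 = a p says -1/d = r + p y with y = -a/d, whence y(y + 1) + 1 = (a^2
  - a d + d^2) / d^2. The powers of \<open>c\<close> cancel up to the sign (-1)^n.\<close>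

lemma sum_V_unit_fraction_cong:
  assumes d: "\<not> p dvd d" and r: "r < p" "d * r + 1 = a * p"
    and W: "\<And>n. W n = of_nat c ^ n * V n (- 1 / of_nat d)" and c: "c > 0"
  shows "p_cong p 4 (\<Sum>n=0..p-1. of_nat (2 * n + 1) * (W n / (- of_nat c) ^ n))
    ((- 1) ^ r * of_nat p + of_nat p ^ 3 *
      ((of_nat a ^ 2 - of_nat a * of_nat d + of_nat d ^ 2) * euler_poly (p - 3) (1 / of_nat d) / of_nat d ^ 2))"
proof -
  define y :: rat where "y = - of_nat a / of_nat d"
  have d0: "(of_nat d :: rat) \<noteq> 0" using d by (auto intro: ccontr)
  have yi: "y \<in> p_integers p" unfolding y_def using d by (intro p_integers_divide_of_nat) auto
  have "(of_nat (d * r + 1) :: rat) = of_nat (a * p)" unfolding r(2) ..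
  then have x: "- 1 / of_nat d = of_nat r + of_nat p * y"
    using d0 unfolding y_def by (simp add: field_simps)
  have "W n / (- of_nat c) ^ n = (- 1) ^ n * V n (- 1 / of_nat d)" for n
    unfolding W using c by (cases "even n") auto
  then have "of_nat (2 * n + 1) * (W n / (- of_nat c) ^ n)
      = of_nat (2 * n + 1) * (- 1) ^ n * V n (- 1 / of_nat d)" for n
    by (simp only: mult.assoc)
  moreover have "of_nat p ^ 3 * (y * (y + 1) + 1) * euler_poly (p - 3) (- (- 1 / of_nat d))
     = of_nat p ^ 3 * ((of_nat a ^ 2 - of_nat a * of_nat d + of_nat d ^ 2)
        * euler_poly (p - 3) (1 / of_nat d) / of_nat d ^ 2)"
  proof -
    have "y * (y + 1) + 1 = (of_nat a ^ 2 - of_nat a * of_nat d + of_nat d ^ 2) / of_nat d ^ 2"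
      using d0 unfolding y_def by (simp add: field_simps power2_eq_square)
    then show ?thesis by simp
  qed
  ultimately show ?thesis using sum_V_cong[OF x yi r(1)] by (simp only:)
qed

text \<open>By Fermat 1/d^2 is d^(p-3) modulo \<open>p\<close>. This produces d^n E_n(1/d) with n =
  p - 3, the form evaluated by generating functions.\<close>

lemma euler_poly_fermat:
  assumes "\<not> p dvd d"
  shows "p_cong p 1 (of_nat k * euler_poly (p - 3) (1 / of_nat d) / of_nat d ^ 2)
    (of_nat k * (of_nat d ^ (p - 3) * euler_poly (p - 3) (1 / of_nat d)))"
proof -
  have d0: "(of_nat d :: rat) \<noteq> 0" using assms by (auto intro: ccontr)
  define A where "A = of_nat k * euler_poly (p - 3) (1 / of_nat d) / (of_nat d ^ 2 :: rat)"
  have "\<not> p dvd d ^ 2" using assms prime_p by (simp add: prime_dvd_power_iff)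
  then have "A \<in> p_integers p"
    unfolding A_def of_nat_power[symmetric] using assms
    by (intro p_integers_divide_of_nat p_integers_mult euler_poly_integral) auto
  then have "p_cong p 1 (A * 1) (A * of_nat d ^ (p - 1))"
    by (intro p_cong_mult p_cong_refl p_cong_sym[OF p_cong_fermat_of_nat] assms)
  moreover have "p - 1 = 2 + (p - 3)" using p_gt_3 by simp
  then have "A * of_nat d ^ (p - 1) = of_nat k * (of_nat d ^ (p - 3) * euler_poly (p - 3) (1 / of_nat d))"
    using d0 unfolding A_def by (simp only: power_add) simp
  ultimately show ?thesis unfolding A_def by simp
qed

lemma V3_sum_cong:
  "p_cong p 4 (\<Sum>n=0..p-1. of_nat (2 * n + 1) * (V3 n / (- 27) ^ n))
    ((- 1) ^ (p div 3) * of_nat p + 7 * of_nat p ^ 3 * of_int (U_num (p - 3)))"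
proof -
  have d: "\<not> p dvd 3" using p_gt_3 by (intro not_p_dvd) auto
  have "\<not> 3 dvd p" using primes_dvd_imp_eq[of 3 p] prime_p p_gt_3 by auto
  define m where "m = p div 3"
  have "p = 3 * m + 1 \<or> p = 3 * m + 2" unfolding m_def using \<open>\<not> 3 dvd p\<close> by presburger
  \<comment> \<open>The residue of -1/3 depends on \<open>p\<close> modulo 3 but always has the
    parity of \<open>p div 3\<close>; and a^2 - 3a + 9 is 7 for both values of
    \<open>a\<close>.\<close>
  then have "\<exists>r a. r < p \<and> 3 * r + 1 = a * p \<and> even (r + p div 3) \<and> (a = 1 \<or> a = 2)"
  proof
    assume p: "p = 3 * m + 1"
    then have "p div 3 = m" by simp
    then show ?thesis using p by (intro exI[of _ m] exI[of _ 1]) auto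
  next
    assume p: "p = 3 * m + 2"
    then have "p div 3 = m" "odd m" using odd_p by auto
    then show ?thesis by (intro exI[of _ "2 * m + 1"] exI[of _ 2]) (auto simp: p)
  qed
  then obtain r a where r: "r < p" "3 * r + 1 = a * p" "even (r + p div 3)" and a: "a = 1 \<or> a = 2"
    by blast
  have sgn: "(- 1 :: rat) ^ r = (- 1) ^ (p div 3)" using r(3) by (cases "even r") auto
  have k: "(of_nat a ^ 2 - of_nat a * of_nat 3 + of_nat 3 ^ 2 :: rat) = of_nat 7" using a by auto
  have W: "V3 n = of_nat 27 ^ n * V n (- 1 / of_nat 3)" for n
    by (simp add: V3_def)
  have "p_cong p 4 (\<Sum>n=0..p-1. of_nat (2 * n + 1) * (V3 n / (- of_nat 27) ^ n))
    ((- 1) ^ (p div 3) * of_nat p + of_nat p ^ 3 * (of_nat 7 * euler_poly (p - 3) (1 / of_nat 3) / of_nat 3 ^ 2))"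
    using sum_V_unit_fraction_cong[OF d r(1,2) W] unfolding sgn k by simp
  from p_cong_scaled_rhs[OF this euler_poly_fermat[OF d]] show ?thesis
    using odd_p p_gt_3 by (simp add: U_num_eq mult_ac)
qed

lemma V4_sum_cong:
  "p_cong p 4 (\<Sum>n=0..p-1. of_nat (2 * n + 1) * (V4 n / (- 64) ^ n))
    ((- 1) ^ (p div 4) * of_nat p + 13 * of_nat p ^ 3 * of_int (s_num (p - 3)))"
proof -
  have d: "\<not> p dvd 4" using prime_dvd_power[OF prime_p, of 2 2] not_p_dvd[of 2] p_gt_3 by auto
  define m where "m = p div 4"
  have "p = 4 * m + 1 \<or> p = 4 * m + 3" unfolding m_def using odd_p by presburger
  \<comment> \<open>Likewise for -1/4: a^2 - 4a + 16 is 13 for a = 1 and for a = 3.\<close>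
  then have "\<exists>r a. r < p \<and> 4 * r + 1 = a * p \<and> even (r + p div 4) \<and> (a = 1 \<or> a = 3)"
  proof
    assume p: "p = 4 * m + 1"
    then have "p div 4 = m" by simp
    then show ?thesis using p by (intro exI[of _ m] exI[of _ 1]) auto
  next
    assume p: "p = 4 * m + 3"
    then have "p div 4 = m" by simp
    then show ?thesis by (intro exI[of _ "3 * m + 2"] exI[of _ 3]) (simp add: p)
  qed
  then obtain r a where r: "r < p" "4 * r + 1 = a * p" "even (r + p div 4)" and a: "a = 1 \<or> a = 3"
    by blast
  have sgn: "(- 1 :: rat) ^ r = (- 1) ^ (p div 4)" using r(3) by (cases "even r") auto
  have k: "(of_nat a ^ 2 - of_nat a * of_nat 4 + of_nat 4 ^ 2 :: rat) = of_nat 13" using a by auto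
  have W: "V4 n = of_nat 64 ^ n * V n (- 1 / of_nat 4)" for n
    by (simp add: V4_def)
  have "p_cong p 4 (\<Sum>n=0..p-1. of_nat (2 * n + 1) * (V4 n / (- of_nat 64) ^ n))
    ((- 1) ^ (p div 4) * of_nat p + of_nat p ^ 3 * (of_nat 13 * euler_poly (p - 3) (1 / of_nat 4) / of_nat 4 ^ 2))"
    using sum_V_unit_fraction_cong[OF d r(1,2) W] unfolding sgn k by simp
  from p_cong_scaled_rhs[OF this euler_poly_fermat[OF d]] show ?thesis
    by (simp add: s_num_eq mult_ac)
qed

lemma V6_sum_cong:
  "p_cong p 4 (\<Sum>n=0..p-1. of_nat (2 * n + 1) * (V6 n / (- 432) ^ n))
    ((- 1) ^ ((p - 1) div 2) * of_nat p + 155 / 9 * of_nat p ^ 3 * of_int (euler_num (p - 3)))"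
proof -
  have d3: "\<not> p dvd 3" and d2: "\<not> p dvd 2" using p_gt_3 not_p_dvd[of 3] not_p_dvd[of 2] by simp_all
  have d: "\<not> p dvd 6" and d18: "\<not> p dvd 18"
    using d3 d2 prime_dvd_mult_iff[OF prime_p, of 2 3] prime_dvd_mult_iff[OF prime_p, of 6 3] by auto
  have "\<not> 3 dvd p" using primes_dvd_imp_eq[of 3 p] prime_p p_gt_3 by auto
  define m where "m = p div 6"
  have "p = 6 * m + 1 \<or> p = 6 * m + 5" unfolding m_def using \<open>\<not> 3 dvd p\<close> odd_p by presburger
  \<comment> \<open>Likewise for -1/6: a^2 - 6a + 36 is 31 for a = 1 and for a = 5.\<close>
  then have "\<exists>r a. r < p \<and> 6 * r + 1 = a * p \<and> even (r + (p - 1) div 2) \<and> (a = 1 \<or> a = 5)"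
  proof
    assume p: "p = 6 * m + 1"
    then have "(p - 1) div 2 = 3 * m" by simp
    then show ?thesis by (intro exI[of _ m] exI[of _ 1]) (simp add: p)
  next
    assume p: "p = 6 * m + 5"
    then have "(p - 1) div 2 = 3 * m + 2" by simp
    then show ?thesis by (intro exI[of _ "5 * m + 4"] exI[of _ 5]) (simp add: p)
  qed
  then obtain r a where r: "r < p" "6 * r + 1 = a * p" "even (r + (p - 1) div 2)" and a: "a = 1 \<or> a = 5"
    by blast
  define E n where "E = (of_int (euler_num (p - 3)) :: rat)" and "n = p - 3"
  have sgn: "(- 1 :: rat) ^ r = (- 1) ^ ((p - 1) div 2)" using r(3) by (cases "even r") auto
  have k: "(of_nat a ^ 2 - of_nat a * of_nat 6 + of_nat 6 ^ 2 :: rat) = of_nat 31" using a by auto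
  have W: "V6 n = of_nat 432 ^ n * V n (- 1 / of_nat 6)" for n
    by (simp add: V6_def)
  have "p_cong p 4 (\<Sum>n=0..p-1. of_nat (2 * n + 1) * (V6 n / (- of_nat 432) ^ n))
    ((- 1) ^ ((p - 1) div 2) * of_nat p + of_nat p ^ 3 * (of_nat 31 * euler_poly (p - 3) (1 / of_nat 6) / of_nat 6 ^ 2))"
    using sum_V_unit_fraction_cong[OF d r(1,2) W] unfolding sgn k by simp
  note S = p_cong_scaled_rhs[OF this euler_poly_fermat[OF d]]
  have "2 * (6 ^ n * euler_poly n (1 / 6)) = (1 + 3 ^ n) * E"
    unfolding E_def n_def using odd_p p_gt_3 by (intro euler_poly_sixth) auto
  moreover have "(3 :: rat) ^ (p - 1) = 9 * 3 ^ n"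
  proof -
    have "p - 1 = 2 + n" using p_gt_3 by (simp add: n_def)
    then show ?thesis by (simp only: power_add) simp
  qed
  \<comment> \<open>The factor (1 + 3^n) / 2 equals (9 + 3^(p-1)) / 18, which Fermat reduces to
    10/18; then 31 * 10/18 = 155/9.\<close>
  ultimately have "of_nat 31 * (of_nat 6 ^ n * euler_poly n (1 / of_nat 6))
      = 31 * E / of_nat 18 * (9 + of_nat 3 ^ (p - 1))"
    by (simp add: algebra_simps)
  also have "p_cong p 1 \<dots> (31 * E / of_nat 18 * (9 + 1))"
    using d18 unfolding E_def
    by (intro p_cong_mult p_cong_add p_cong_refl p_cong_fermat_of_nat d3 p_integers_divide_of_nat) auto
  also have "31 * E / of_nat 18 * (9 + 1) = 155 / 9 * E" by simp
  finally have "p_cong p 1 (of_nat 31 * (of_nat 6 ^ n * euler_poly n (1 / of_nat 6))) (155 / 9 * E)" .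
  from p_cong_scaled_rhs[OF S[folded n_def] this] show ?thesis
    by (simp add: E_def mult_ac)
qed

lemma sum_V_residue_cong:
  assumes "x \<in> p_integers p"
  shows "let r = p_residue p x; x' = (x - of_nat r) / of_nat p in
    p_cong p 4 (\<Sum>n=0..p-1. of_nat (2 * n + 1) * (- 1) ^ n * V n x)
      ((- 1) ^ r * of_nat p + of_nat p ^ 3 * (x' * (x' + 1) + 1) * euler_poly (p - 3) (- x))"
proof -
  obtain r where r: "r < p" "p_cong p 1 x (of_nat r)" using ex_p_residue[OF assms] by blast
  obtain y where y: "y \<in> p_integers p" "x = of_nat r + of_nat p ^ 1 * y"
    using r(2) by (rule p_congE)
  \<comment> \<open>The cofactor in the congruence of \<open>x\<close> with its residue is x'
    itself, so x' is \<open>p\<close>-integral.\<close>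
  then have "(x - of_nat r) / of_nat p = y" using p_gt_3 by simp
  then show ?thesis
    unfolding p_residue_eqI[OF r] Let_def using sum_V_cong[OF _ y(1) r(1)] y(2) by simp
qed

end

end

theorem theorem4p6:
  fixes p :: nat
  assumes "prime p" and "p > 3"
  shows "(\<forall>x\<in>p_integers p.
            let r = p_residue p x; x' = (x - of_nat r) / of_nat p in
              p_cong p 4 (\<Sum>n=0..p-1. of_nat (2 * n + 1) * (- 1) ^ n * V n x)
                ((- 1) ^ r * of_nat p
                  + of_nat p ^ 3 * (x' * (x' + 1) + 1) * euler_poly (p - 3) (- x)))
       \<and> p_cong p 4 (\<Sum>n=0..p-1. of_nat (2 * n + 1) * (V3 n / (- 27) ^ n))
           ((- 1) ^ (p div 3) * of_nat p + 7 * of_nat p ^ 3 * of_int (U_num (p - 3)))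
       \<and> p_cong p 4 (\<Sum>n=0..p-1. of_nat (2 * n + 1) * (V4 n / (- 64) ^ n))
           ((- 1) ^ (p div 4) * of_nat p + 13 * of_nat p ^ 3 * of_int (s_num (p - 3)))
       \<and> p_cong p 4 (\<Sum>n=0..p-1. of_nat (2 * n + 1) * (V6 n / (- 432) ^ n))
           ((- 1) ^ ((p - 1) div 2) * of_nat p
             + 155 / 9 * of_nat p ^ 3 * of_int (euler_num (p - 3)))"
  by (intro conjI ballI sum_V_residue_cong[OF assms] V3_sum_cong[OF assms] V4_sum_cong[OF assms]
      V6_sum_cong[OF assms])

end
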